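(* Let $M$ and $N$ be differentiable manifolds of dimensions $m$ and $n$. If $u\colon M\to N$ is colocally weakly differentiable, then for almost every $x\in M$, the colocal weak derivative $Du(x)$ is the approximate derivative of $u$ at $x$.
   Context: Manifolds are Hausdorff and have a countable basis. Negligible sets, measurable maps, locally integrable functions and weakly differentiable real functions on $M$ are defined through local charts. A map $u\colon M\to N$ is colocally weakly differentiable if $u$ is measurable and $f\circ u$ is weakly differentiable for every $f\in C^1_c(N,\mathbb{R})$. Its colocal weak derivative is the (existing and almost everywhere unique) measurable bundle morphism $Du\colon TM\to TN$ covering $u$ (i.e. $Du(x)\colon T_xM\to T_{u(x)}N$ is linear) such that for every $f\in C^1_c(N,\mathbb{R})$, $D(f\circ u)=Df\circ Du$ almost everywhere in $M$. Let $x\in M$. A linear map $\xi\colon T_xM\to T_{u(x)}N$ is an approximate derivative of $u$ at $x$ if there exist local charts $\psi\colon V\to\psi(V)\subseteq\mathbb{R}^m$ with $V\subseteq M$ open, $x\in V$, and $\varphi\colon U\to\varphi(U)\subseteq\mathbb{R}^n$ with $U\subseteq N$ open, $u(x)\in U$, such that for every $\varepsilon>0$ $$\lim_{\rho\to0}\rho^{-m}\mathcal{L}^m\bigl(\psi(A_\varepsilon)\cap B_\rho(\psi(x))\bigr)=0,$$ where $A_\varepsilon$ is the set of $y\in V$ such that either $u(y)\notin U$, or $u(y)\in U$ and $$\bigl|\varphi(u(y))-\varphi(u(x))-\bigl(D\varphi(u(x))\circ\xi\circ(D\psi(x))^{-1}\bigr)[\psi(y)-\psi(x)]\bigr|>\varepsilon|\psi(y)-\psi(x)|.$$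 Here $\mathcal{L}^m$ is Lebesgue measure. The approximate derivative at a point is unique when it exists. *)

theory Defs
  imports "HOL-Analysis.Analysis"
begin

section \<open>Maps of class $C^1$ on open subsets of Euclidean spaces\<close>

definition C1_on :: "'a::real_normed_vector set \<Rightarrow> ('a \<Rightarrow> 'b::real_normed_vector) \<Rightarrow> bool" where
  "C1_on S f \<longleftrightarrow> (\<exists>f'. (\<forall>x\<in>S. (f has_derivative blinfun_apply (f' x)) (at x)) \<and> continuous_on S f')"


section \<open>Manifolds\<close>

text \<open>
  A chart is a pair of an open domain and a map; only the values of the map on the domain matter.
  A manifold is a Hausdorff, second countable type (this is in the type classes) with a \<open>C\<^sup>1\<close> atlas,
  and its dimension is \<open>CARD('m)\<close>.  Its local charts are those of the maximal atlas.
\<close>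

type_synonym ('a, 'm) chart = "'a set \<times> ('a \<Rightarrow> real ^ 'm)"

definition chart_inv :: "('a, 'm::finite) chart \<Rightarrow> real ^ 'm \<Rightarrow> 'a" where
  "chart_inv c = inv_into (fst c) (snd c)"

definition is_chart :: "('a::topological_space, 'm::finite) chart \<Rightarrow> bool" where
  "is_chart c \<longleftrightarrow> open (fst c) \<and> open (snd c ` fst c) \<and>
     homeomorphism (fst c) (snd c ` fst c) (snd c) (chart_inv c)"

definition C1_compatible ::
    "('a::topological_space, 'm::finite) chart \<Rightarrow> ('a, 'm) chart \<Rightarrow> bool" where
  "C1_compatible c d \<longleftrightarrow>
     C1_on (snd c ` (fst c \<inter> fst d)) (snd d \<circ> chart_inv c) \<and>
     C1_on (snd d ` (fst c \<inter> fst d)) (snd c \<circ> chart_inv d)"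

definition C1_atlas :: "('a::topological_space, 'm::finite) chart set \<Rightarrow> bool" where
  "C1_atlas A \<longleftrightarrow> (\<forall>c\<in>A. is_chart c) \<and> (\<forall>c\<in>A. \<forall>d\<in>A. C1_compatible c d) \<and> (\<Union>c\<in>A. fst c) = UNIV"

definition local_charts ::
    "('a::topological_space, 'm::finite) chart set \<Rightarrow> ('a, 'm) chart set" where
  "local_charts A = {c. is_chart c \<and> (\<forall>d\<in>A. C1_compatible c d)}"

definition charts_at ::
    "('a::topological_space, 'm::finite) chart set \<Rightarrow> 'a \<Rightarrow> ('a, 'm) chart set" where
  "charts_at A x = {c \<in> local_charts A. x \<in> fst c}"


section \<open>Tangent spaces\<close>

text \<open>
  A tangent vector at \<open>x\<close> is the family of its components in the local charts at \<open>x\<close>; these are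
  related by the derivatives of the transition maps.  (Derivations would not do: on a \<open>C\<^sup>1\<close> manifold
  they form an infinite-dimensional space.)  The value \<open>0\<close> away from the charts at \<open>x\<close> makes the
  representation unique, so that the vector space operations are the pointwise ones.
\<close>

type_synonym ('a, 'm) tangent = "('a, 'm) chart \<Rightarrow> real ^ 'm"

definition tangent_space ::
    "('a::topological_space, 'm::finite) chart set \<Rightarrow> 'a \<Rightarrow> ('a, 'm) tangent set" where
  "tangent_space A x = {v.
     (\<forall>c\<in>charts_at A x. \<forall>d\<in>charts_at A x.
        v d = frechet_derivative (snd d \<circ> chart_inv c) (at (snd c x)) (v c)) \<and>
     (\<forall>c. c \<notin> charts_at A x \<longrightarrow> v c = 0)}"

text \<open>For a chart \<open>c = (V, \<psi>)\<close> at \<open>x\<close>, this is \<open>D\<psi>(x) : T\<^sub>xM \<rightarrow> \<real>\<^sup>m\<close>.\<close>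

definition chart_deriv :: "('a, 'm) chart \<Rightarrow> ('a, 'm) tangent \<Rightarrow> real ^ 'm" where
  "chart_deriv c v = v c"

definition chart_deriv_inv ::
    "('a::topological_space, 'm::finite) chart set \<Rightarrow> ('a, 'm) chart \<Rightarrow> 'a \<Rightarrow> real ^ 'm
      \<Rightarrow> ('a, 'm) tangent" where
  "chart_deriv_inv A c x = inv_into (tangent_space A x) (chart_deriv c)"

definition tangent_linear ::
    "('a::topological_space, 'm::finite) chart set \<Rightarrow> ('b::topological_space, 'n::finite) chart set
      \<Rightarrow> 'a \<Rightarrow> 'b \<Rightarrow> (('a, 'm) tangent \<Rightarrow> ('b, 'n) tangent) \<Rightarrow> bool" where
  "tangent_linear A B x y \<xi> \<longleftrightarrow>
     (\<forall>v\<in>tangent_space A x. \<xi> v \<in> tangent_space B y) \<and>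
     (\<forall>v\<in>tangent_space A x. \<forall>w\<in>tangent_space A x. \<xi> (\<lambda>c. v c + w c) = (\<lambda>d. \<xi> v d + \<xi> w d)) \<and>
     (\<forall>r. \<forall>v\<in>tangent_space A x. \<xi> (\<lambda>c. r *\<^sub>R v c) = (\<lambda>d. r *\<^sub>R \<xi> v d))"


section \<open>Real functions of class $C^1$ on a manifold\<close>

definition C1c_fun :: "('b::topological_space, 'n::finite) chart set \<Rightarrow> ('b \<Rightarrow> real) \<Rightarrow> bool" where
  "C1c_fun B f \<longleftrightarrow> (\<forall>d\<in>local_charts B. C1_on (snd d ` fst d) (f \<circ> chart_inv d)) \<and>
     compact (closure {y. f y \<noteq> 0})"

text \<open>\<open>Df(y) : T\<^sub>yN \<rightarrow> \<real>\<close>, computed in some chart at \<open>y\<close>; by the chain rule the choice is immaterial.\<close>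

definition fun_deriv ::
    "('b::topological_space, 'n::finite) chart set \<Rightarrow> ('b \<Rightarrow> real) \<Rightarrow> 'b \<Rightarrow> ('b, 'n) tangent \<Rightarrow> real" where
  "fun_deriv B f y v =
     (let d = (SOME d. d \<in> charts_at B y)
      in frechet_derivative (f \<circ> chart_inv d) (at (snd d y)) (chart_deriv d v))"


section \<open>Negligible sets and measurable maps\<close>

definition negligible_in :: "('a::topological_space, 'm::finite) chart set \<Rightarrow> 'a set \<Rightarrow> bool" where
  "negligible_in A E \<longleftrightarrow> (\<forall>c\<in>local_charts A. negligible (snd c ` (E \<inter> fst c)))"

definition almost_everywhere_in ::
    "('a::topological_space, 'm::finite) chart set \<Rightarrow> ('a \<Rightarrow> bool) \<Rightarrow> bool" where
  "almost_everywhere_in A P \<longleftrightarrow> negligible_in A {x. \<not> P x}"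

definition measurable_map ::
    "('a::topological_space, 'm::finite) chart set \<Rightarrow> ('a \<Rightarrow> 'b::topological_space) \<Rightarrow> bool" where
  "measurable_map A u \<longleftrightarrow>
     (\<forall>c\<in>local_charts A. u \<circ> chart_inv c \<in> borel_measurable (lebesgue_on (snd c ` fst c)))"


section \<open>Weakly differentiable real functions\<close>

definition locally_integrable_on :: "(real ^ 'm::finite \<Rightarrow> real) \<Rightarrow> (real ^ 'm) set \<Rightarrow> bool" where
  "locally_integrable_on g \<Omega> \<longleftrightarrow> (\<forall>K. compact K \<and> K \<subseteq> \<Omega> \<longrightarrow> set_integrable lebesgue K g)"

definition test_function :: "(real ^ 'm::finite) set \<Rightarrow> (real ^ 'm \<Rightarrow> real) \<Rightarrow> bool" where
  "test_function \<Omega> \<eta> \<longleftrightarrow> C1_on UNIV \<eta> \<and> compact (closure {z. \<eta> z \<noteq> 0}) \<and> closure {z. \<eta> z \<noteq> 0} \<subseteq> \<Omega>"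

text \<open>
  \<open>G z w\<close> is the weak derivative at \<open>z\<close> in the direction \<open>w\<close>.  Since the manifolds are only of
  class \<open>C\<^sup>1\<close>, test functions are of class \<open>C\<^sup>1\<close>; on Euclidean open sets smooth ones
  would define the same notion.
\<close>

definition has_weak_derivative_on ::
    "(real ^ 'm::finite \<Rightarrow> real) \<Rightarrow> (real ^ 'm \<Rightarrow> real ^ 'm \<Rightarrow> real) \<Rightarrow> (real ^ 'm) set \<Rightarrow> bool" where
  "has_weak_derivative_on g G \<Omega> \<longleftrightarrow>
     locally_integrable_on g \<Omega> \<and>
     (\<forall>z\<in>\<Omega>. linear (G z)) \<and>
     (\<forall>w. locally_integrable_on (\<lambda>z. G z w) \<Omega>) \<and>
     (\<forall>\<eta> w. test_function \<Omega> \<eta> \<longrightarrow>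
        (LINT z:\<Omega>|lebesgue. g z * frechet_derivative \<eta> (at z) w) =
        - (LINT z:\<Omega>|lebesgue. G z w * \<eta> z))"

definition weakly_differentiable ::
    "('a::topological_space, 'm::finite) chart set \<Rightarrow> ('a \<Rightarrow> real) \<Rightarrow> bool" where
  "weakly_differentiable A g \<longleftrightarrow>
     (\<forall>c\<in>local_charts A. \<exists>G. has_weak_derivative_on (g \<circ> chart_inv c) G (snd c ` fst c))"

text \<open>\<open>G x : T\<^sub>xM \<rightarrow> \<real>\<close> is the weak derivative of \<open>g\<close>, that is, it represents it in every local chart.\<close>

definition weak_derivative ::
    "('a::topological_space, 'm::finite) chart set \<Rightarrow> ('a \<Rightarrow> real)
      \<Rightarrow> ('a \<Rightarrow> ('a, 'm) tangent \<Rightarrow> real) \<Rightarrow> bool" where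
  "weak_derivative A g G \<longleftrightarrow>
     (\<forall>c\<in>local_charts A. has_weak_derivative_on (g \<circ> chart_inv c)
        (\<lambda>z w. G (chart_inv c z) (chart_deriv_inv A c (chart_inv c z) w)) (snd c ` fst c))"


section \<open>Colocal weak differentiability\<close>

definition colocally_weakly_differentiable ::
    "('a::topological_space, 'm::finite) chart set \<Rightarrow> ('b::topological_space, 'n::finite) chart set
      \<Rightarrow> ('a \<Rightarrow> 'b) \<Rightarrow> bool" where
  "colocally_weakly_differentiable A B u \<longleftrightarrow>
     measurable_map A u \<and> (\<forall>f. C1c_fun B f \<longrightarrow> weakly_differentiable A (f \<circ> u))"

text \<open>The last conjunct is measurability of the matrix coefficients in local trivializations.\<close>

definition measurable_bundle_morphism ::
    "('a::topological_space, 'm::finite) chart set \<Rightarrow> ('b::topological_space, 'n::finite) chart set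
      \<Rightarrow> ('a \<Rightarrow> 'b) \<Rightarrow> ('a \<Rightarrow> ('a, 'm) tangent \<Rightarrow> ('b, 'n) tangent) \<Rightarrow> bool" where
  "measurable_bundle_morphism A B u D \<longleftrightarrow>
     measurable_map A u \<and>
     (\<forall>x. tangent_linear A B x (u x) (D x)) \<and>
     (\<forall>c\<in>local_charts A. \<forall>d\<in>local_charts B. \<forall>w.
        (\<lambda>z. chart_deriv d (D (chart_inv c z) (chart_deriv_inv A c (chart_inv c z) w)))
          \<in> borel_measurable (lebesgue_on (snd c ` (fst c \<inter> u -` fst d))))"

text \<open>A weak derivative is only determined almost everywhere, hence a relation and not a function of \<open>u\<close>.\<close>

definition colocal_weak_derivative ::
    "('a::topological_space, 'm::finite) chart set \<Rightarrow> ('b::topological_space, 'n::finite) chart set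
      \<Rightarrow> ('a \<Rightarrow> 'b) \<Rightarrow> ('a \<Rightarrow> ('a, 'm) tangent \<Rightarrow> ('b, 'n) tangent) \<Rightarrow> bool" where
  "colocal_weak_derivative A B u D \<longleftrightarrow>
     measurable_bundle_morphism A B u D \<and>
     (\<forall>f. C1c_fun B f \<longrightarrow>
        (\<exists>G. weak_derivative A (f \<circ> u) G \<and>
           almost_everywhere_in A (\<lambda>x. \<forall>v\<in>tangent_space A x. G x v = fun_deriv B f (u x) (D x v))))"


section \<open>Approximate derivatives\<close>

definition exceptional_set ::
    "('a::topological_space, 'm::finite) chart set
      \<Rightarrow> ('a \<Rightarrow> 'b) \<Rightarrow> 'a \<Rightarrow> (('a, 'm) tangent \<Rightarrow> ('b, 'n::finite) tangent)
      \<Rightarrow> ('a, 'm) chart \<Rightarrow> ('b, 'n) chart \<Rightarrow> real \<Rightarrow> 'a set" where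
  "exceptional_set A u x \<xi> c d \<epsilon> =
     {y \<in> fst c. u y \<notin> fst d \<or>
        u y \<in> fst d \<and>
        norm (snd d (u y) - snd d (u x)
              - chart_deriv d (\<xi> (chart_deriv_inv A c x (snd c y - snd c x))))
          > \<epsilon> * norm (snd c y - snd c x)}"

text \<open>
  The measurability requirement is there because \<open>measure\<close> is \<open>0\<close> on sets that are not
  measurable; it is automatic when \<open>u\<close> is measurable.
\<close>

definition approximate_derivative ::
    "('a::topological_space, 'm::finite) chart set \<Rightarrow> ('b::topological_space, 'n::finite) chart set
      \<Rightarrow> ('a \<Rightarrow> 'b) \<Rightarrow> 'a \<Rightarrow> (('a, 'm) tangent \<Rightarrow> ('b, 'n) tangent) \<Rightarrow> bool" where
  "approximate_derivative A B u x \<xi> \<longleftrightarrow>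
     tangent_linear A B x (u x) \<xi> \<and>
     (\<exists>c\<in>charts_at A x. \<exists>d\<in>charts_at B (u x). \<forall>\<epsilon>>0.
        snd c ` exceptional_set A u x \<xi> c d \<epsilon> \<in> sets lebesgue \<and>
        ((\<lambda>\<rho>. measure lebesgue (snd c ` exceptional_set A u x \<xi> c d \<epsilon> \<inter> ball (snd c x) \<rho>)
               / \<rho> ^ CARD('m)) \<longlongrightarrow> 0) (at_right 0))"

end

theory Submission
  imports Defs
begin

text \<open>
  In a chart of the source, every composition \<open>g\<close> of \<open>u\<close> with a compactly supported function is weakly
  differentiable, with weak derivative \<open>G\<close>.  At a common Lebesgue point \<open>x\<close> of \<open>g\<close> and \<open>G\<close> put
  \<open>h z = g z - g x - G x (z - x)\<close>.  For a test function \<open>\<eta>\<close> supported in the unit ball, consider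
  \<open>D s = \<integral> h z * \<eta> ((z - x) / s) / s ^ m dz\<close>.  Testing the weak derivative with the field
  \<open>w \<mapsto> \<eta> w *\<^sub>R w\<close> gives
  \<open>D' s = \<integral> (G z - G x) ((z - x) / s) * \<eta> ((z - x) / s) / s ^ m dz\<close>, which is at most
  \<open>sup \<bar>\<eta>\<bar>\<close> times \<open>s ^ (- m)\<close> times the integral of \<open>\<bar>G z - G x\<bar>\<close> over the ball of radius \<open>s\<close>, and hence
  tends to \<open>0\<close> uniformly in \<open>\<eta>\<close>.  As \<open>D\<close> tends to \<open>0\<close> at \<open>0\<close>, this makes \<open>D r = o(r)\<close>; taking the
  supremum over \<open>\<eta>\<close>, the integral of \<open>\<bar>h\<bar>\<close> over the ball of radius \<open>r\<close> is \<open>o(r ^ (m + 1))\<close>, and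
  Chebyshev's inequality yields approximate differentiability.  Countably many systems of compactly
  supported functions that extend local coordinates, each with a cutoff detecting whether \<open>u\<close> leaves
  the chart, suffice for the target.
\<close>

section \<open>Lebesgue points\<close>

text \<open>The derivative in \<open>s\<close> of the kernel
  \<open>\<eta> ((z - x) / s) / s ^ m\<close> is minus the divergence of the kernel times
  \<open>(z - x) / s\<close>. This moves the derivative from the kernel to \<open>g\<close>, and
  what remains contains only values of \<open>\<eta>\<close>, no derivatives. The estimate thus
  depends on the supremum of \<open>\<eta>\<close> alone, which is what makes duality applicable.
  The other obstacle is that \<open>u\<close> need not be continuous: points \<open>y\<close> with
  \<open>u y\<close> outside a given chart may occur arbitrarily close to \<open>x\<close>, and no
  shrinking of the source domain removes them. Compositions with compactly supported functions
  remain defined there. At such a point a cutoff equal to \<open>1\<close> near \<open>u x\<close>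
  drops to \<open>0\<close>; near \<open>x\<close> this makes its remainder at least
  \<open>\<epsilon> * \<bar>y - x\<bar>\<close>, so the same Chebyshev estimate also counts these
  points.\<close>

lemma lebesgue_integral_diagonal_affine:
  fixes c :: "'a::euclidean_space \<Rightarrow> real" and f :: "'a \<Rightarrow> real" and t :: 'a
  assumes c: "\<And>j. j \<in> Basis \<Longrightarrow> c j \<noteq> 0" and f: "integrable lebesgue f"
  defines "T \<equiv> (\<lambda>x. t + (\<Sum>j\<in>Basis. (c j * (x \<bullet> j)) *\<^sub>R j))"
  shows "integrable lebesgue (\<lambda>x. f (T x))"
    and "integral\<^sup>L lebesgue f = (\<Prod>j\<in>Basis. \<bar>c j\<bar>) * (\<integral>x. f (T x) \<partial>lebesgue)"
proof -
  have T: "T \<in> lebesgue \<rightarrow>\<^sub>M lebesgue"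
    unfolding T_def by (rule lebesgue_affine_measurable) (rule c)
  define p where "p = (\<Prod>j\<in>Basis. \<bar>c j\<bar>)"
  have p: "p > 0" unfolding p_def using c by (auto intro!: prod_pos)
  have L: "lebesgue = density (distr lebesgue lebesgue T) (\<lambda>_. ennreal p)"
    unfolding T_def p_def by (rule lebesgue_affine_euclidean) (rule c)
  have fm: "f \<in> borel_measurable lebesgue" using f by simp
  have "integrable (density (distr lebesgue lebesgue T) (\<lambda>_. ennreal p)) f"
    using f L by simp
  then have "integrable (distr lebesgue lebesgue T) (\<lambda>x. p * f x)"
    using p fm by (subst (asm) integrable_density) auto
  then have "integrable (distr lebesgue lebesgue T) f"
    using p by simp
  then show "integrable lebesgue (\<lambda>x. f (T x))"
    using T fm by (subst (asm) integrable_distr_eq) auto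
  have "integral\<^sup>L lebesgue f = integral\<^sup>L (density (distr lebesgue lebesgue T) (\<lambda>_. ennreal p)) f"
    using L by simp
  also have "\<dots> = (\<integral>x. p * f x \<partial>distr lebesgue lebesgue T)"
    using p fm by (subst integral_density) auto
  also have "\<dots> = p * (\<integral>x. f x \<partial>distr lebesgue lebesgue T)" by simp
  also have "\<dots> = p * (\<integral>x. f (T x) \<partial>lebesgue)"
    using T fm by (subst integral_distr) auto
  finally show "integral\<^sup>L lebesgue f = (\<Prod>j\<in>Basis. \<bar>c j\<bar>) * (\<integral>x. f (T x) \<partial>lebesgue)"
    by (simp add: p_def)
qed

lemma set_integrable_const_lmeasurable:
  fixes c :: real
  assumes "S \<in> lmeasurable"
  shows "set_integrable lebesgue S (\<lambda>_. c)"
proof -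
  have "integrable lebesgue (indicat_real S)"
    using assms by (intro integrable_real_indicator) (auto simp: fmeasurable_def)
  then show ?thesis unfolding set_integrable_def by simp
qed

text \<open>Differentiating the integrals of \<open>\<bar>f y - c\<bar>\<close> for every rational
  \<open>c\<close> discards only countably many null sets; off their union, a rational close to
  \<open>f x\<close> can stand in for \<open>f x\<close>. Cubes with lower corner \<open>x\<close>
  appear because \<open>integrable_ccontinuous_explicit\<close> averages over these.\<close>

lemma Lebesgue_points_corner:
  fixes f :: "'a::euclidean_space \<Rightarrow> real"
  assumes f: "integrable lebesgue f"
  obtains N where "negligible N"
    "\<And>x e. x \<notin> N \<Longrightarrow> e > 0 \<Longrightarrow> \<exists>d>0. \<forall>h. 0 < h \<and> h < d \<longrightarrow>
        (LINT y:cbox x (x + h *\<^sub>R One)|lebesgue. \<bar>f y - f x\<bar>) \<le> e * h ^ DIM('a)"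
proof -
  have int: "set_integrable lebesgue (cbox a b) f" for a b
    unfolding set_integrable_def by (rule integrable_mult_indicator[OF _ f]) simp
  have intc: "set_integrable lebesgue (cbox a b) (\<lambda>y. \<bar>f y - c\<bar>)" for a b c
  proof -
    have "set_integrable lebesgue (cbox a b) (\<lambda>y. c)"
      by (rule set_integrable_const_lmeasurable) simp
    from set_integral_diff(1)[OF int this] show ?thesis
      by (intro set_integrable_abs)
  qed
  have "\<exists>N. negligible N \<and> (\<forall>x e. x \<notin> N \<longrightarrow> 0 < e \<longrightarrow>
       (\<exists>d>0. \<forall>h. 0 < h \<and> h < d \<longrightarrow>
         norm (integral (cbox x (x + h *\<^sub>R One)) (\<lambda>y. \<bar>f y - c\<bar>) /\<^sub>R h ^ DIM('a) - \<bar>f x - c\<bar>) < e))" for c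
  proof -
    have "(\<lambda>y. \<bar>f y - c\<bar>) integrable_on cbox a b" for a b
      using intc set_lebesgue_integral_eq_integral(1) by blast
    from integrable_ccontinuous_explicit[OF this] show ?thesis by metis
  qed
  then obtain N where N: "\<And>c. negligible (N c)"
    and N': "\<And>c x e. x \<notin> N c \<Longrightarrow> 0 < e \<Longrightarrow>
       (\<exists>d>0. \<forall>h. 0 < h \<and> h < d \<longrightarrow>
         norm (integral (cbox x (x + h *\<^sub>R One)) (\<lambda>y. \<bar>f y - c\<bar>) /\<^sub>R h ^ DIM('a) - \<bar>f x - c\<bar>) < e)"
    by metis
  show ?thesis
  proof (rule that[of "\<Union>c\<in>\<rat>. N c"])
    show "negligible (\<Union>c\<in>\<rat>. N c)"
      by (rule negligible_countable_Union) (use N countable_rat in auto)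
    fix x e assume x: "x \<notin> (\<Union>c\<in>\<rat>. N c)" and e: "(e::real) > 0"
    \<comment> \<open>This distance is spent twice, in replacing \<open>f x\<close> by
      \<open>c\<close> and as the limit of the averages at \<open>x\<close>; the last third covers
      the averages for small \<open>h\<close>.\<close>
    obtain c where c: "c \<in> \<rat>" "\<bar>f x - c\<bar> < e / 3"
    proof -
      obtain q where q: "f x - e / 3 < of_rat q" "of_rat q < f x + e / 3"
        using of_rat_dense[of "f x - e / 3" "f x + e / 3"] e by auto
      then have "\<bar>f x - of_rat q\<bar> < e / 3" by linarith
      then show thesis by (rule that[rotated]) simp
    qed
    have "x \<notin> N c" using x c by auto
    from N'[OF this, of "e/3"] e obtain d where d: "d > 0" and
      dh: "\<And>h. 0 < h \<Longrightarrow> h < d \<Longrightarrow>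
         norm (integral (cbox x (x + h *\<^sub>R One)) (\<lambda>y. \<bar>f y - c\<bar>) /\<^sub>R h ^ DIM('a) - \<bar>f x - c\<bar>) < e / 3"
      by auto
    have "(LINT y:cbox x (x + h *\<^sub>R One)|lebesgue. \<bar>f y - f x\<bar>) \<le> e * h ^ DIM('a)" if h: "0 < h" "h < d" for h
    proof -
      let ?B = "cbox x (x + h *\<^sub>R One)"
      have hp: "h ^ DIM('a) > 0" using h by simp
      have box: "measure lebesgue ?B = h ^ DIM('a)"
      proof -
        have "measure lebesgue ?B = measure lborel ?B" by (rule measure_completion) simp
        also have "\<dots> = h ^ DIM('a)" using h by (subst content_cbox) (auto simp: inner_simps)
        finally show ?thesis .
      qed
      have ci: "set_integrable lebesgue ?B (\<lambda>y. \<bar>c - f x\<bar>)"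
        by (rule set_integrable_const_lmeasurable) simp
      have "(LINT y:?B|lebesgue. \<bar>f y - f x\<bar>) \<le> (LINT y:?B|lebesgue. \<bar>f y - c\<bar> + \<bar>c - f x\<bar>)"
        by (intro set_integral_mono set_integral_add intc ci) auto
      also have "\<dots> = (LINT y:?B|lebesgue. \<bar>f y - c\<bar>) + (LINT y:?B|lebesgue. \<bar>c - f x\<bar>)"
        by (intro set_integral_add intc ci)
      also have "(LINT y:?B|lebesgue. \<bar>c - f x\<bar>) = \<bar>c - f x\<bar> * h ^ DIM('a)"
        unfolding set_lebesgue_integral_def using box by simp
      also have "(LINT y:?B|lebesgue. \<bar>f y - c\<bar>) = integral ?B (\<lambda>y. \<bar>f y - c\<bar>)"
        using intc set_lebesgue_integral_eq_integral(2) by blast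
      also have "\<dots> \<le> (\<bar>f x - c\<bar> + e/3) * h ^ DIM('a)"
      proof -
        have "integral ?B (\<lambda>y. \<bar>f y - c\<bar>) /\<^sub>R h ^ DIM('a) = integral ?B (\<lambda>y. \<bar>f y - c\<bar>) / h ^ DIM('a)"
          by (simp only: real_scaleR_def divide_inverse mult.commute)
        with dh[OF h] have "integral ?B (\<lambda>y. \<bar>f y - c\<bar>) / h ^ DIM('a) \<le> \<bar>f x - c\<bar> + e/3"
          unfolding real_norm_def by linarith
        then show ?thesis by (simp only: pos_divide_le_eq[OF hp])
      qed
      finally have "(LINT y:?B|lebesgue. \<bar>f y - f x\<bar>) \<le> (\<bar>f x - c\<bar> + e/3 + \<bar>c - f x\<bar>) * h ^ DIM('a)"
        by (simp only: distrib_right)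
      also have "\<dots> \<le> e * h ^ DIM('a)"
        using c(2) hp by (intro mult_right_mono) linarith+
      finally show ?thesis .
    qed
    with d show "\<exists>d>0. \<forall>h. 0 < h \<and> h < d \<longrightarrow>
        (LINT y:cbox x (x + h *\<^sub>R One)|lebesgue. \<bar>f y - f x\<bar>) \<le> e * h ^ DIM('a)" by blast
  qed
qed

text \<open>The corner cubes of the reflected functions at the reflected points cover the balls.\<close>

lemma Lebesgue_points:
  fixes f :: "'a::euclidean_space \<Rightarrow> real"
  assumes f: "integrable lebesgue f"
  obtains N where "negligible N"
    "\<And>x e. x \<notin> N \<Longrightarrow> e > 0 \<Longrightarrow> \<exists>d>0. \<forall>h. 0 < h \<and> h < d \<longrightarrow>
        (LINT y:cball x h|lebesgue. \<bar>f y - f x\<bar>) \<le> e * h ^ DIM('a)"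
proof -
  \<comment> \<open>For \<open>s\<close> in \<open>S\<close>, \<open>T s\<close> is a measure
    preserving involution that reflects some of the coordinates. It carries the lower-corner cube at
    \<open>T s x\<close> to the cube at \<open>x\<close> in the orthant with signs
    \<open>s\<close>.\<close>
  define S where "S = (Basis :: 'a set) \<rightarrow>\<^sub>E {-1, 1 :: real}"
  define T where "T = (\<lambda>s (x::'a). (\<Sum>j\<in>Basis. (s j * (x \<bullet> j)) *\<^sub>R j))"
  have S: "finite S" unfolding S_def by (auto intro: finite_PiE)
  have sj: "s j = -1 \<or> s j = 1" if "s \<in> S" "j \<in> Basis" for s j
    using that unfolding S_def by auto
  have s0: "s j \<noteq> 0" if "s \<in> S" "j \<in> Basis" for s j
    using sj[OF that] by auto
  have Tj: "T s x \<bullet> j = s j * (x \<bullet> j)" if "j \<in> Basis" for s x j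
    unfolding T_def using that by (simp add: inner_sum_left inner_Basis if_distrib sum.delta cong: if_cong)
  have TT: "T s (T s x) = x" if "s \<in> S" for s x
  proof (rule euclidean_eqI)
    fix j :: 'a assume "j \<in> Basis"
    then show "T s (T s x) \<bullet> j = x \<bullet> j" using sj[OF that] Tj by force
  qed
  have lin: "linear (T s)" for s
    unfolding T_def by (intro linearI) (auto simp: inner_simps algebra_simps sum.distrib scaleR_sum_right)
  have prod1: "(\<Prod>j\<in>Basis. \<bar>s j\<bar>) = 1" if "s \<in> S" for s
  proof -
    have "\<bar>s j\<bar> = 1" if "j \<in> Basis" for j using sj[OF \<open>s \<in> S\<close> that] by auto
    then show ?thesis by simp
  qed
  have refl: "integrable lebesgue (\<lambda>x. g (T s x))" "integral\<^sup>L lebesgue g = (\<integral>x. g (T s x) \<partial>lebesgue)"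
    if "s \<in> S" "integrable lebesgue g" for s and g :: "'a \<Rightarrow> real"
    using lebesgue_integral_diagonal_affine[of s g 0, OF s0[OF that(1)] that(2)] prod1[OF that(1)]
    by (simp_all add: T_def)
  have "\<exists>N. negligible N \<and> (\<forall>x e. x \<notin> N \<longrightarrow> 0 < e \<longrightarrow>
       (\<exists>d>0. \<forall>h. 0 < h \<and> h < d \<longrightarrow>
        (LINT y:cbox x (x + h *\<^sub>R One)|lebesgue. \<bar>f (T s y) - f (T s x)\<bar>) \<le> e * h ^ DIM('a)))" if "s \<in> S" for s
    using Lebesgue_points_corner[OF refl(1)[OF that f]] by metis
  then obtain N where N: "\<And>s. s \<in> S \<Longrightarrow> negligible (N s)"
    and N': "\<And>s x e. s \<in> S \<Longrightarrow> x \<notin> N s \<Longrightarrow> 0 < e \<Longrightarrow>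
       (\<exists>d>0. \<forall>h. 0 < h \<and> h < d \<longrightarrow>
        (LINT y:cbox x (x + h *\<^sub>R One)|lebesgue. \<bar>f (T s y) - f (T s x)\<bar>) \<le> e * h ^ DIM('a))"
    by metis
  show ?thesis
  proof (rule that[of "\<Union>s\<in>S. T s ` N s"])
    show "negligible (\<Union>s\<in>S. T s ` N s)"
    proof (intro negligible_Union)
      fix A assume "A \<in> (\<lambda>s. T s ` N s) ` S"
      then obtain s where s: "s \<in> S" "A = T s ` N s" by blast
      show "negligible A" unfolding s(2)
        by (rule negligible_differentiable_image_negligible[OF order_refl N[OF s(1)]
            linear_imp_differentiable_on[OF lin]])
    qed (use S in auto)
    fix x e assume x: "x \<notin> (\<Union>s\<in>S. T s ` N s)" and e: "(e::real) > 0"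
    \<comment> \<open>Each of the \<open>card S\<close> cubes gets the share \<open>e / k\<close>;
      adding \<open>1\<close> makes \<open>k\<close> positive at once.\<close>
    define k where "k = real (card S) + 1"
    have k: "k > 0" unfolding k_def by simp
    have "\<exists>d>0. \<forall>h. 0 < h \<and> h < d \<longrightarrow>
        (LINT y:cbox (T s x) (T s x + h *\<^sub>R One)|lebesgue. \<bar>f (T s y) - f x\<bar>) \<le> (e / k) * h ^ DIM('a)"
      if s: "s \<in> S" for s
    proof -
      have "T s x \<notin> N s" using x s TT[OF s, of x] by force
      from N'[OF s this, of "e / k"] TT[OF s] e k show ?thesis by simp
    qed
    then obtain d where d: "\<And>s. s \<in> S \<Longrightarrow> d s > 0" and
      dh: "\<And>s h. s \<in> S \<Longrightarrow> 0 < h \<Longrightarrow> h < d s \<Longrightarrow>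
        (LINT y:cbox (T s x) (T s x + h *\<^sub>R One)|lebesgue. \<bar>f (T s y) - f x\<bar>) \<le> (e / k) * h ^ DIM('a)"
      by metis
    define d0 where "d0 = Min (insert 1 (d ` S))"
    have d0: "d0 > 0" "\<And>s. s \<in> S \<Longrightarrow> d0 \<le> d s"
      unfolding d0_def using S d by auto
    have "(LINT y:cball x h|lebesgue. \<bar>f y - f x\<bar>) \<le> e * h ^ DIM('a)" if h: "0 < h" "h < d0" for h
    proof -
      have hp: "h ^ DIM('a) > 0" using h by simp
      define B where "B = (\<lambda>s. cbox (T s x) (T s x + h *\<^sub>R One))"
      have fi: "integrable lebesgue (\<lambda>y. indicator K y *\<^sub>R \<bar>f y - f x\<bar>)"
        if "K \<in> lmeasurable" for K
      proof -
        have "set_integrable lebesgue K f" unfolding set_integrable_def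
          using that by (intro integrable_mult_indicator f) auto
        moreover have "set_integrable lebesgue K (\<lambda>y. f x)"
          using that by (rule set_integrable_const_lmeasurable)
        ultimately have "set_integrable lebesgue K (\<lambda>y. f y - f x)" by (rule set_integral_diff(1))
        then have "set_integrable lebesgue K (\<lambda>y. \<bar>f y - f x\<bar>)" by (rule set_integrable_abs)
        then show ?thesis by (simp add: set_integrable_def)
      qed
      have TB: "T s ` B s \<in> lmeasurable" for s
        unfolding B_def by (rule measurable_linear_image_interval) (rule lin)
      have ind: "indicator (T s ` B s) (T s y) = (indicator (B s) y :: real)" if "s \<in> S" for s y
      proof -
        have "T s y \<in> T s ` B s \<longleftrightarrow> y \<in> B s"
          using TT[OF that] by (metis imageE imageI)
        then show ?thesis by (simp add: indicator_def)
      qed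
      have each: "(\<integral>y. indicator (T s ` B s) y *\<^sub>R \<bar>f y - f x\<bar> \<partial>lebesgue) \<le> (e / k) * h ^ DIM('a)"
        if s: "s \<in> S" for s
        using dh[OF s h(1)] d0(2)[OF s] h refl(2)[OF s fi[OF TB[of s]]] ind[OF s]
        by (simp add: set_lebesgue_integral_def B_def)
      have cover: "\<exists>s\<in>S. y \<in> T s ` B s" if "y \<in> cball x h" for y
      proof -
        \<comment> \<open>The orthant of \<open>y\<close> as seen from \<open>x\<close>: with these
          signs all coordinates of \<open>T s y - T s x\<close> are nonnegative.\<close>
        define s where "s = restrict (\<lambda>j. if y \<bullet> j \<ge> x \<bullet> j then 1 else - 1 :: real) Basis"
        have s: "s \<in> S" unfolding S_def s_def by auto
        have "T s y \<in> B s"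
          unfolding B_def mem_box
        proof (intro ballI)
          fix j :: 'a assume j: "j \<in> Basis"
          have "\<bar>(y - x) \<bullet> j\<bar> \<le> h"
            using Basis_le_norm[OF j, of "y - x"] that by (simp add: dist_norm norm_minus_commute)
          with j show "T s x \<bullet> j \<le> T s y \<bullet> j \<and> T s y \<bullet> j \<le> (T s x + h *\<^sub>R One) \<bullet> j"
            unfolding Tj[OF j] inner_add_left s_def by (auto simp: inner_diff_left)
        qed
        then have "y \<in> T s ` B s" using TT[OF s, of y] by (metis imageI)
        with s show ?thesis by blast
      qed
      have "(LINT y:cball x h|lebesgue. \<bar>f y - f x\<bar>) \<le>
          (\<integral>y. (\<Sum>s\<in>S. indicator (T s ` B s) y *\<^sub>R \<bar>f y - f x\<bar>) \<partial>lebesgue)"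
        unfolding set_lebesgue_integral_def
      proof (intro integral_mono Bochner_Integration.integrable_sum fi TB)
        fix y
        show "indicat_real (cball x h) y *\<^sub>R \<bar>f y - f x\<bar> \<le> (\<Sum>s\<in>S. indicat_real (T s ` B s) y *\<^sub>R \<bar>f y - f x\<bar>)"
        proof (cases "y \<in> cball x h")
          case True
          with cover obtain s where s: "s \<in> S" "y \<in> T s ` B s" by blast
          have "indicat_real (T s ` B s) y *\<^sub>R \<bar>f y - f x\<bar> \<le> (\<Sum>s\<in>S. indicat_real (T s ` B s) y *\<^sub>R \<bar>f y - f x\<bar>)"
            using s S by (intro member_le_sum) auto
          then show ?thesis using s True by simp
        next
          case False
          then show ?thesis by (auto intro!: sum_nonneg)
        qed
      qed (simp add: fi)
      also have "\<dots> = (\<Sum>s\<in>S. \<integral>y. indicator (T s ` B s) y *\<^sub>R \<bar>f y - f x\<bar> \<partial>lebesgue)"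
        by (intro Bochner_Integration.integral_sum fi TB)
      also have "\<dots> \<le> (\<Sum>s\<in>S. (e / k) * h ^ DIM('a))" by (intro sum_mono each)
      also have "\<dots> = (real (card S) / k) * (e * h ^ DIM('a))" by simp
      also have "\<dots> \<le> 1 * (e * h ^ DIM('a))"
        using e hp by (intro mult_right_mono) (auto simp: k_def)
      finally show ?thesis by simp
    qed
    with d0 show "\<exists>d>0. \<forall>h. 0 < h \<and> h < d \<longrightarrow>
        (LINT y:cball x h|lebesgue. \<bar>f y - f x\<bar>) \<le> e * h ^ DIM('a)" by blast
  qed
qed

text \<open>A locally negligible set is negligible, so it suffices to cut off near each point.\<close>

lemma Lebesgue_points_locally_integrable:
  fixes f :: "real ^ 'm::finite \<Rightarrow> real"
  assumes f: "locally_integrable_on f \<Omega>" and \<Omega>: "open \<Omega>"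
  shows "negligible {x \<in> \<Omega>. \<not> (\<forall>e>0. \<exists>d>0. \<forall>h. 0 < h \<and> h < d \<longrightarrow>
        (LINT y:cball x h|lebesgue. \<bar>f y - f x\<bar>) \<le> e * h ^ CARD('m))}"
proof -
  define P where "P = (\<lambda>(f :: real ^ 'm \<Rightarrow> real) x. \<forall>e>0. \<exists>d>0. \<forall>h. 0 < h \<and> h < d \<longrightarrow>
        (LINT y:cball x h|lebesgue. \<bar>f y - f x\<bar>) \<le> e * h ^ CARD('m))"
  have "negligible {x\<in>\<Omega>. \<not> P f x}"
  proof (subst locally_negligible_alt, rule ballI)
    fix x assume x: "x \<in> {x\<in>\<Omega>. \<not> P f x}"
    then have "x \<in> \<Omega>" by simp
    with open_contains_cball[THEN iffD1, OF \<Omega>] have "\<exists>r>0. cball x r \<subseteq> \<Omega>" by (rule bspec)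
    then obtain r where r: "r > 0" "cball x r \<subseteq> \<Omega>" by (elim exE conjE)
    define g where "g = (\<lambda>y. indicator (cball x r) y *\<^sub>R f y)"
    have gi: "integrable lebesgue g"
    proof -
      have "set_integrable lebesgue (cball x r) f"
        using f r(2) compact_cball[of x r] unfolding locally_integrable_on_def by simp
      then show ?thesis unfolding set_integrable_def g_def .
    qed
    obtain N where N: "negligible N" and N': "\<And>y e. y \<notin> N \<Longrightarrow> e > 0 \<Longrightarrow> \<exists>d>0. \<forall>h. 0 < h \<and> h < d \<longrightarrow>
        (LINT z:cball y h|lebesgue. \<bar>g z - g y\<bar>) \<le> e * h ^ DIM(real ^ 'm)"
      by (rule Lebesgue_points[OF gi]) (rule that)
    have Pg: "P g y" if "y \<notin> N" for y
      using N'[OF that] unfolding P_def by simp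
    have "P f y" if "y \<in> ball x r" "P g y" for y
      unfolding P_def
    proof (intro allI impI)
      fix e :: real assume "e > 0"
      then have "\<exists>d>0. \<forall>h. 0 < h \<and> h < d \<longrightarrow>
          (LINT z:cball y h|lebesgue. \<bar>g z - g y\<bar>) \<le> e * h ^ CARD('m)"
        using that(2) unfolding P_def by blast
      then obtain d where d: "d > 0" "\<And>h. 0 < h \<and> h < d \<longrightarrow>
        (LINT z:cball y h|lebesgue. \<bar>g z - g y\<bar>) \<le> e * h ^ CARD('m)" by blast
      have eq: "(LINT z:cball y h|lebesgue. \<bar>f z - f y\<bar>) = (LINT z:cball y h|lebesgue. \<bar>g z - g y\<bar>)"
        if h: "h < r - dist x y" for h
      proof (rule set_lebesgue_integral_cong)
        show "\<forall>z. z \<in> cball y h \<longrightarrow> \<bar>f z - f y\<bar> = \<bar>g z - g y\<bar>"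
        proof (intro allI impI)
          fix z assume "z \<in> cball y h"
          then have "dist x z \<le> r" "dist x y \<le> r"
            using h \<open>y \<in> ball x r\<close> dist_triangle[of x z y] unfolding mem_ball mem_cball by linarith+
          then show "\<bar>f z - f y\<bar> = \<bar>g z - g y\<bar>" by (simp add: g_def)
        qed
      qed auto
      show "\<exists>d>0. \<forall>h. 0 < h \<and> h < d \<longrightarrow>
        (LINT z:cball y h|lebesgue. \<bar>f z - f y\<bar>) \<le> e * h ^ CARD('m)"
      proof (intro exI[of _ "min d (r - dist x y)"] conjI allI impI)
        show "0 < min d (r - dist x y)" using d(1) that by simp
        fix h assume "0 < h \<and> h < min d (r - dist x y)"
        then show "(LINT z:cball y h|lebesgue. \<bar>f z - f y\<bar>) \<le> e * h ^ CARD('m)"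
          using d(2)[of h] eq[of h] by simp
      qed
    qed
    then have "ball x r \<inter> {x\<in>\<Omega>. \<not> P f x} \<subseteq> N"
      using Pg by blast
    then have "negligible ({x\<in>\<Omega>. \<not> P f x} \<inter> ball x r)"
      using negligible_subset[OF N] by (simp add: inf_commute)
    then show "\<exists>U. openin (top_of_set {x\<in>\<Omega>. \<not> P f x}) U \<and> x \<in> U \<and> negligible U"
    proof (intro exI conjI)
      show "openin (top_of_set {x\<in>\<Omega>. \<not> P f x}) ({x\<in>\<Omega>. \<not> P f x} \<inter> ball x r)"
        by (rule openin_open_Int) simp
      show "x \<in> {x\<in>\<Omega>. \<not> P f x} \<inter> ball x r" using x r(1) by simp
    qed
  qed
  then show ?thesis unfolding P_def .
qed


section \<open>Test functions\<close>

lemma C1_onI: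
  "(\<And>x. x \<in> S \<Longrightarrow> (f has_derivative blinfun_apply (f' x)) (at x)) \<Longrightarrow> continuous_on S f' \<Longrightarrow> C1_on S f"
  unfolding C1_on_def by blast

lemma C1_on_differentiable: "C1_on S f \<Longrightarrow> x \<in> S \<Longrightarrow> f differentiable (at x)"
  unfolding C1_on_def differentiable_def by blast

lemma C1_on_has_derivative:
  "C1_on S f \<Longrightarrow> x \<in> S \<Longrightarrow> (f has_derivative frechet_derivative f (at x)) (at x)"
  using C1_on_differentiable frechet_derivative_works by blast

lemma C1_on_imp_continuous_on: "C1_on S f \<Longrightarrow> continuous_on S f"
  unfolding C1_on_def
  by (meson continuous_at_imp_continuous_on has_derivative_continuous)

lemma C1_on_frechet:
  assumes "C1_on S f"
  shows "continuous_on S (\<lambda>x. Blinfun (frechet_derivative f (at x)))"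
proof -
  obtain f' where f': "\<And>x. x \<in> S \<Longrightarrow> (f has_derivative blinfun_apply (f' x)) (at x)" "continuous_on S f'"
    using assms unfolding C1_on_def by blast
  then have "Blinfun (frechet_derivative f (at x)) = f' x" if "x \<in> S" for x
    using frechet_derivative_at[OF f'(1)[OF that]] by (metis blinfun_apply_inverse)
  then show ?thesis using f'(2) by (simp cong: continuous_on_cong)
qed

text \<open>\<open>C1_on\<close> hides its derivative behind an existential quantifier. The Frechet
  derivative is a canonical witness, so that continuity on two open sets can be glued without
  comparing witnesses.\<close>

lemma C1_on_iff_frechet:
  "C1_on S f \<longleftrightarrow> (\<forall>x\<in>S. f differentiable (at x)) \<and> continuous_on S (\<lambda>x. Blinfun (frechet_derivative f (at x)))"
    (is "_ \<longleftrightarrow> ?R")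
proof
  show "C1_on S f \<Longrightarrow> ?R" using C1_on_frechet C1_on_differentiable by blast
  assume R: ?R
  show "C1_on S f"
  proof (rule C1_onI[where f' = "\<lambda>x. Blinfun (frechet_derivative f (at x))"])
    fix x assume "x \<in> S"
    then have "(f has_derivative frechet_derivative f (at x)) (at x)"
      using R frechet_derivative_works by blast
    then show "(f has_derivative blinfun_apply (Blinfun (frechet_derivative f (at x)))) (at x)"
      by (simp add: bounded_linear_Blinfun_apply has_derivative_bounded_linear)
  qed (use R in blast)
qed

lemma C1_on_open_Un:
  assumes "open S" "open T" "C1_on S f" "C1_on T f"
  shows "C1_on (S \<union> T) f"
  using assms unfolding C1_on_iff_frechet by (auto intro: continuous_on_open_Un)

lemma C1_on_cong_open:
  assumes "open S" "C1_on S f" "\<And>x. x \<in> S \<Longrightarrow> f x = g x"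
  shows "C1_on S g"
  using assms unfolding C1_on_def
  by (metis has_derivative_transform_within_open)

lemma C1_on_const: "C1_on S (\<lambda>_. c)"
  by (rule C1_onI[where f' = "\<lambda>_. 0"]) (auto simp: zero_blinfun.rep_eq)

lemma C1_on_bounded_linear: "bounded_linear f \<Longrightarrow> C1_on S f"
  by (rule C1_onI[where f' = "\<lambda>_. Blinfun f"])
    (auto simp: bounded_linear_Blinfun_apply intro: bounded_linear_imp_has_derivative)

lemma C1_on_add:
  assumes "C1_on S f" "C1_on S g"
  shows "C1_on S (\<lambda>x. f x + g x)"
proof -
  obtain f' g' where "\<And>x. x \<in> S \<Longrightarrow> (f has_derivative blinfun_apply (f' x)) (at x)" "continuous_on S f'"
    "\<And>x. x \<in> S \<Longrightarrow> (g has_derivative blinfun_apply (g' x)) (at x)" "continuous_on S g'"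
    using assms unfolding C1_on_def by blast
  then show ?thesis
    by (intro C1_onI[where f' = "\<lambda>x. f' x + g' x"])
      (auto simp: plus_blinfun.rep_eq intro!: continuous_intros has_derivative_add)
qed

lemma C1_on_mult:
  fixes f g :: "'a::real_normed_vector \<Rightarrow> real"
  assumes f: "C1_on S f" and g: "C1_on S g"
  shows "C1_on S (\<lambda>x. f x * g x)"
proof -
  obtain f' g' where *: "\<And>x. x \<in> S \<Longrightarrow> (f has_derivative blinfun_apply (f' x)) (at x)" "continuous_on S f'"
    "\<And>x. x \<in> S \<Longrightarrow> (g has_derivative blinfun_apply (g' x)) (at x)" "continuous_on S g'"
    using assms unfolding C1_on_def by blast
  show ?thesis
  proof (rule C1_onI[where f' = "\<lambda>x. f x *\<^sub>R g' x + g x *\<^sub>R f' x"])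
    fix x assume "x \<in> S"
    from has_derivative_mult[OF *(1,3)[OF this]]
    show "((\<lambda>x. f x * g x) has_derivative blinfun_apply (f x *\<^sub>R g' x + g x *\<^sub>R f' x)) (at x)"
      by (simp add: plus_blinfun.rep_eq scaleR_blinfun.rep_eq algebra_simps)
  qed (intro continuous_intros * C1_on_imp_continuous_on f g)
qed

lemma C1_on_compose:
  assumes f: "C1_on S f" and g: "C1_on T g" and "f ` S \<subseteq> T"
  shows "C1_on S (\<lambda>x. g (f x))"
proof -
  obtain f' g' where *: "\<And>x. x \<in> S \<Longrightarrow> (f has_derivative blinfun_apply (f' x)) (at x)" "continuous_on S f'"
    "\<And>x. x \<in> T \<Longrightarrow> (g has_derivative blinfun_apply (g' x)) (at x)" "continuous_on T g'"
    using f g unfolding C1_on_def by blast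
  show ?thesis
  proof (rule C1_onI[where f' = "\<lambda>x. g' (f x) o\<^sub>L f' x"])
    fix x assume "x \<in> S"
    then have "f x \<in> T" using \<open>f ` S \<subseteq> T\<close> by blast
    from diff_chain_at[OF *(1)[OF \<open>x \<in> S\<close>] *(3)[OF this]]
    show "((\<lambda>x. g (f x)) has_derivative blinfun_apply (g' (f x) o\<^sub>L f' x)) (at x)"
      by (simp add: o_def blinfun_compose.rep_eq)
  next
    have "continuous_on S (\<lambda>x. g' (f x))"
      using \<open>f ` S \<subseteq> T\<close> by (intro continuous_on_compose2[OF *(4)] C1_on_imp_continuous_on f)
    then show "continuous_on S (\<lambda>x. g' (f x) o\<^sub>L f' x)"
      using *(2) by (rule bounded_bilinear.continuous_on[OF bounded_bilinear_blinfun_compose])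
  qed
qed

section \<open>Polynomials, cutoffs and the approximation of signs\<close>

lemma C1_on_real_polynomial_function: "real_polynomial_function f \<Longrightarrow> C1_on S f"
  by (induction rule: real_polynomial_function.induct)
    (auto intro: C1_on_bounded_linear C1_on_const C1_on_add C1_on_mult)

text \<open>A cutoff profile that is just regular enough: test functions are only of class C1, so
  this can replace the usual exponential.\<close>

lemma C1_on_positive_part_square: "C1_on S (\<lambda>t::real. (max 0 t)\<^sup>2)"
proof (rule C1_onI[where f' = "\<lambda>t. (2 * max 0 t) *\<^sub>R id_blinfun"])
  fix t :: real
  have "((\<lambda>t. (max 0 t)\<^sup>2) has_real_derivative 2 * max 0 t) (at t)"
  proof -
    consider "t > 0" | "t < 0" | "t = 0" by linarith
    then show ?thesis
    proof cases
      case 1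
      have "((\<lambda>t. t\<^sup>2) has_real_derivative 2 * t) (at t)" by (auto intro!: derivative_eq_intros)
      then have "((\<lambda>t. (max 0 t)\<^sup>2) has_real_derivative 2 * t) (at t)"
        by (rule has_field_derivative_transform_within_open[where S = "{0<..}"]) (use 1 in auto)
      with 1 show ?thesis by simp
    next
      case 2
      have "((\<lambda>t. 0) has_real_derivative 0) (at t)" by simp
      then have "((\<lambda>t. (max 0 t)\<^sup>2) has_real_derivative 0) (at t)"
        by (rule has_field_derivative_transform_within_open[where S = "{..<0}"]) (use 2 in auto)
      with 2 show ?thesis by simp
    next
      case 3
      \<comment> \<open>For nonzero \<open>h\<close> the difference quotient
        \<open>(max 0 h)\<^sup>2 / h\<close> equals \<open>max 0 h\<close>.\<close>
      have "((\<lambda>h::real. max 0 h) \<longlongrightarrow> max 0 0) (at 0)" by (intro tendsto_intros)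
      then have "((\<lambda>h. ((max 0 (0 + h))\<^sup>2 - (max 0 0)\<^sup>2) / h) \<longlongrightarrow> 0) (at (0::real))"
        by (rule filterlim_cong[THEN iffD1, rotated 3])
          (auto simp: power2_eq_square max_def eventually_at intro!: exI[of _ 1])
      with 3 show ?thesis by (simp add: DERIV_def)
    qed
  qed
  then show "((\<lambda>t. (max 0 t)\<^sup>2) has_derivative blinfun_apply ((2 * max 0 t) *\<^sub>R id_blinfun)) (at t)"
    by (simp add: has_field_derivative_def blinfun.scaleR_left[abs_def] id_blinfun.rep_eq)
qed (intro continuous_intros)

lemma C1_bump:
  fixes x :: "'a::euclidean_space"
  assumes "0 \<le> a" "a < b"
  obtains \<beta> :: "'a \<Rightarrow> real" where "C1_on UNIV \<beta>" "\<And>z. 0 \<le> \<beta> z" "\<And>z. \<beta> z \<le> 1"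
    "\<And>z. dist x z \<le> a \<Longrightarrow> \<beta> z = 1" "\<And>z. b \<le> dist x z \<Longrightarrow> \<beta> z = 0"
proof -
  define p where "p = (\<lambda>t::real. (max 0 t)\<^sup>2)"
  have p: "C1_on UNIV p" unfolding p_def by (rule C1_on_positive_part_square)
  \<comment> \<open>\<open>q\<close> is at least \<open>1\<close> within distance \<open>a\<close>
    of \<open>x\<close> and at most \<open>0\<close> from distance \<open>b\<close> on. The inner
    \<open>p\<close> turns the latter into an exact \<open>0\<close>, the outer one, applied to
    \<open>1 - p (q z)\<close>, the former into an exact \<open>1\<close>. Differences are written
    as sums with a factor \<open>-1\<close> to fit the closure rules.\<close>
  define q where "q = (\<lambda>z. (b\<^sup>2 + (-1) * (\<Sum>i\<in>Basis. (z \<bullet> i + - (x \<bullet> i))^2)) * inverse (b\<^sup>2 - a\<^sup>2))"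
  define \<beta> where "\<beta> = (\<lambda>z. 1 + (-1) * p (1 + (-1) * p (q z)))"
  have ab: "b\<^sup>2 - a\<^sup>2 > 0" using assms by (simp add: power_strict_mono)
  have "real_polynomial_function q"
    unfolding q_def
    by (intro real_polynomial_function_sum real_polynomial_function_power real_polynomial_function.intros
        bounded_linear_inner_left finite_Basis)
  then have q: "C1_on UNIV q" by (rule C1_on_real_polynomial_function)
  have C: "C1_on UNIV \<beta>" unfolding \<beta>_def
    by (intro C1_on_add C1_on_mult C1_on_const C1_on_compose[OF _ p] q subset_UNIV)
  have p01: "0 \<le> p t" "t \<le> 1 \<Longrightarrow> p t \<le> 1" "t \<le> 0 \<Longrightarrow> p t = 0" "t \<ge> 1 \<Longrightarrow> p t \<ge> 1" for t
    unfolding p_def by (auto simp: power_le_one max_def)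
  have p1: "p 1 = 1" unfolding p_def by simp
  have qz: "q z = (b\<^sup>2 - (dist x z)\<^sup>2) / (b\<^sup>2 - a\<^sup>2)" for z
  proof -
    have "(\<Sum>i\<in>Basis. (z \<bullet> i + - (x \<bullet> i))^2) = (dist x z)\<^sup>2"
      by (subst euclidean_dist_l2) (simp add: L2_set_def sum_nonneg dist_real_def power2_commute)
    then show ?thesis unfolding q_def by (simp add: divide_inverse)
  qed
  show thesis
  proof
    show "C1_on UNIV \<beta>" by (rule C)
    show "0 \<le> \<beta> z" "\<beta> z \<le> 1" for z
      unfolding \<beta>_def using p01(2)[of "1 - p (q z)"] p01(1) by auto
    show "\<beta> z = 1" if "dist x z \<le> a" for z
    proof -
      have "(dist x z)\<^sup>2 \<le> a\<^sup>2" using that by (simp add: power_mono)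
      then have "q z \<ge> 1" unfolding qz using ab by simp
      then show ?thesis unfolding \<beta>_def using p01(3)[of "1 - p (q z)"] p01(4)[of "q z"] by simp
    qed
    show "\<beta> z = 0" if "b \<le> dist x z" for z
    proof -
      have "b\<^sup>2 \<le> (dist x z)\<^sup>2" using that assms by (simp add: power_mono)
      then have "q z \<le> 0" unfolding qz using ab by (simp add: divide_le_0_iff)
      then show ?thesis unfolding \<beta>_def using p01(3)[of "q z"] p1 by simp
    qed
  qed
qed

lemma C1_on_borel_measurable_lebesgue:
  fixes f :: "'a::euclidean_space \<Rightarrow> real"
  assumes "C1_on UNIV f"
  shows "f \<in> borel_measurable lebesgue"
  by (rule measurable_completion)
    (simp add: borel_measurable_continuous_onI C1_on_imp_continuous_on[OF assms])

text \<open>The integral of \<open>\<bar>h\<bar>\<close> is that of \<open>h * sgn h\<close>, and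
  \<open>sgn h\<close> is almost everywhere a limit of admissible \<open>\<theta>\<close>:
  continuous functions, approximated uniformly by polynomials and cut off near the sphere. The
  approximants may slightly exceed \<open>1\<close>, whence a hypothesis that is homogeneous in
  \<open>K\<close>.\<close>

lemma L1_bound_by_duality:
  fixes h :: "'a::euclidean_space \<Rightarrow> real"
  assumes h: "set_integrable lebesgue (cball x r) h" and r: "r > 0"
    and bound: "\<And>\<theta> K. C1_on UNIV \<theta> \<Longrightarrow> (\<And>z. z \<notin> cball x r \<Longrightarrow> \<theta> z = 0) \<Longrightarrow> (\<And>z. \<bar>\<theta> z\<bar> \<le> K) \<Longrightarrow>
      (LINT z:cball x r|lebesgue. h z * \<theta> z) \<le> C * K"
  shows "(LINT z:cball x r|lebesgue. \<bar>h z\<bar>) \<le> C"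
proof -
  define H where "H = (\<lambda>z. indicator (cball x r) z * h z)"
  have H: "integrable lebesgue H" using h unfolding H_def set_integrable_def by simp
  have "(\<lambda>z. sgn (H z)) \<in> borel_measurable lebesgue"
    by (rule measurable_compose[OF _ borel_measurable_sgn]) (use H in auto)
  then have "(\<lambda>z. sgn (H z)) measurable_on UNIV"
    by (simp add: measurable_on_iff_borel_measurable)
  then obtain N g where N: "negligible N" and g: "\<And>n. continuous_on UNIV (g n)"
    and lim: "\<And>z. z \<notin> N \<Longrightarrow> (\<lambda>n. g n z) \<longlonglongrightarrow> sgn (H z)"
    unfolding measurable_on_def by auto
  \<comment> \<open>Clamping to \<open>[-1, 1]\<close> preserves the limit, whose values lie there,
    and leads to the uniform bound for dominated convergence.\<close>
  define f where "f = (\<lambda>n z. max (-1) (min 1 (g n z)))"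
  have f: "continuous_on (cball x r) (f n)" for n
    unfolding f_def by (intro continuous_intros continuous_on_subset[OF g]) auto
  have limf: "(\<lambda>n. f n z) \<longlonglongrightarrow> sgn (H z)" if "z \<notin> N" for z
  proof -
    have "(\<lambda>n. f n z) \<longlonglongrightarrow> max (-1) (min 1 (sgn (H z)))"
      unfolding f_def by (intro tendsto_intros lim that)
    then show ?thesis by (simp add: sgn_if)
  qed
  have "\<exists>p. real_polynomial_function p \<and> (\<forall>z\<in>cball x r. \<bar>f n z - p z\<bar> < inverse (Suc n))" for n
    using Stone_Weierstrass_real_polynomial_function[OF compact_cball f, of "inverse (Suc n)"]
    by (metis inverse_positive_iff_positive of_nat_0_less_iff zero_less_Suc)
  then obtain p where p: "\<And>n. real_polynomial_function (p n)"
    and pf: "\<And>n z. z \<in> cball x r \<Longrightarrow> \<bar>f n z - p n z\<bar> < inverse (Suc n)" by metis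
  \<comment> \<open>The inner radii increase to \<open>r\<close>, so at each point of the open ball
    the cutoff is eventually exactly \<open>1\<close>; only the sphere, a null set, is lost.\<close>
  have "\<exists>\<beta> :: 'a \<Rightarrow> real. C1_on UNIV \<beta> \<and> (\<forall>z. 0 \<le> \<beta> z \<and> \<beta> z \<le> 1) \<and>
      (\<forall>z. dist x z \<le> r * (1 - inverse (Suc n)) \<longrightarrow> \<beta> z = 1) \<and> (\<forall>z. r \<le> dist x z \<longrightarrow> \<beta> z = 0)" for n
  proof -
    have "0 \<le> r * (1 - inverse (real (Suc n)))" "r * (1 - inverse (real (Suc n))) < r"
      using r by (auto simp: field_simps)
    then show ?thesis by (rule C1_bump) blast
  qed
  then obtain \<beta> :: "nat \<Rightarrow> 'a \<Rightarrow> real" where \<beta>: "\<And>n. C1_on UNIV (\<beta> n)" "\<And>n z. 0 \<le> \<beta> n z" "\<And>n z. \<beta> n z \<le> 1"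
    "\<And>n z. dist x z \<le> r * (1 - inverse (Suc n)) \<Longrightarrow> \<beta> n z = 1" "\<And>n z. r \<le> dist x z \<Longrightarrow> \<beta> n z = 0"
    by metis
  define \<theta> where "\<theta> = (\<lambda>n z. \<beta> n z * p n z)"
  have \<theta>1: "C1_on UNIV (\<theta> n)" for n
    unfolding \<theta>_def by (intro C1_on_mult \<beta> C1_on_real_polynomial_function p)
  have \<theta>0: "\<theta> n z = 0" if "z \<notin> cball x r" for n z
    unfolding \<theta>_def using that \<beta>(5) by simp
  have \<theta>K: "\<bar>\<theta> n z\<bar> \<le> 1 + inverse (Suc n)" for n z
  proof (cases "z \<in> cball x r")
    case True
    have "\<bar>f n z\<bar> \<le> 1" unfolding f_def by auto
    then have "\<bar>p n z\<bar> \<le> 1 + inverse (Suc n)" using pf[OF True, of n] by linarith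
    then have "\<bar>\<beta> n z\<bar> * \<bar>p n z\<bar> \<le> 1 * (1 + inverse (Suc n))"
      using \<beta>(2,3)[of n z] by (intro mult_mono) auto
    then show ?thesis unfolding \<theta>_def by (simp add: abs_mult)
  next
    case False
    then show ?thesis using \<theta>0 by simp
  qed
  have L1: "(\<lambda>n. \<integral>z. H z * \<theta> n z \<partial>lebesgue) \<longlonglongrightarrow> (\<integral>z. \<bar>H z\<bar> \<partial>lebesgue)"
  proof (rule integral_dominated_convergence[where w = "\<lambda>z. 2 * \<bar>H z\<bar>"])
    show "(\<lambda>z. \<bar>H z\<bar>) \<in> borel_measurable lebesgue" using H by auto
    show "integrable lebesgue (\<lambda>z. 2 * \<bar>H z\<bar>)" using H by auto
    have "\<theta> n \<in> borel_measurable lebesgue" for n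
      by (rule C1_on_borel_measurable_lebesgue[OF \<theta>1])
    then show "(\<lambda>z. H z * \<theta> n z) \<in> borel_measurable lebesgue" for n
      using H by auto
    have "norm (H z * \<theta> n z) \<le> 2 * \<bar>H z\<bar>" for n z
    proof -
      have "inverse (real (Suc n)) \<le> 1" by (simp add: field_simps)
      then have "\<bar>\<theta> n z\<bar> \<le> 2" using \<theta>K[of n z] by linarith
      then have "\<bar>H z\<bar> * \<bar>\<theta> n z\<bar> \<le> \<bar>H z\<bar> * 2" by (intro mult_left_mono) auto
      then show ?thesis by (simp add: abs_mult)
    qed
    then show "AE z in lebesgue. norm (H z * \<theta> n z) \<le> 2 * \<bar>H z\<bar>" for n by simp
    have null: "N \<union> sphere x r \<in> null_sets lebesgue"
      using N negligible_sphere negligible_Un negligible_iff_null_sets by blast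
    have conv: "(\<lambda>n. H z * \<theta> n z) \<longlonglongrightarrow> \<bar>H z\<bar>" if z: "z \<notin> N \<union> sphere x r" for z
    proof (cases "z \<in> cball x r")
      case False
      then show ?thesis by (simp add: H_def)
    next
      case True
      with z have dz: "dist x z < r" by auto
      have "(\<lambda>n. r * (1 - inverse (real (Suc n)))) \<longlonglongrightarrow> r * (1 - 0)"
        by (intro tendsto_intros LIMSEQ_inverse_real_of_nat)
      then have "eventually (\<lambda>n. dist x z < r * (1 - inverse (real (Suc n)))) sequentially"
        using dz by (auto dest: order_tendstoD)
      then have ev: "eventually (\<lambda>n. p n z = \<theta> n z) sequentially"
        by eventually_elim (use \<beta>(4)[of z] in \<open>auto simp: \<theta>_def\<close>)
      have "(\<lambda>n. p n z - f n z) \<longlonglongrightarrow> 0"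
      proof (rule Lim_null_comparison[OF _ LIMSEQ_inverse_real_of_nat])
        show "\<forall>\<^sub>F n in sequentially. norm (p n z - f n z) \<le> inverse (real (Suc n))"
          using pf[OF True] by (auto simp: abs_minus_commute less_imp_le intro!: always_eventually)
      qed
      from tendsto_add[OF this limf[of z]] z have "(\<lambda>n. p n z) \<longlonglongrightarrow> sgn (H z)" by simp
      then have "(\<lambda>n. \<theta> n z) \<longlonglongrightarrow> sgn (H z)" using ev by (rule Lim_transform_eventually)
      then have "(\<lambda>n. H z * \<theta> n z) \<longlonglongrightarrow> H z * sgn (H z)" by (rule tendsto_mult_left)
      then show ?thesis by (simp add: abs_sgn)
    qed
    show "AE z in lebesgue. (\<lambda>n. H z * \<theta> n z) \<longlonglongrightarrow> \<bar>H z\<bar>"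
      by (rule AE_I'[OF null]) (use conv in blast)
  qed
  have L2: "(\<lambda>n. C * (1 + inverse (real (Suc n)))) \<longlonglongrightarrow> C * (1 + 0)"
    by (intro tendsto_intros LIMSEQ_inverse_real_of_nat)
  have L3: "(\<integral>z. H z * \<theta> n z \<partial>lebesgue) \<le> C * (1 + inverse (real (Suc n)))" for n
    using bound[OF \<theta>1 \<theta>0 \<theta>K] by (simp add: set_lebesgue_integral_def H_def mult.assoc)
  have "(\<integral>z. \<bar>H z\<bar> \<partial>lebesgue) \<le> C * (1 + 0)"
    by (rule LIMSEQ_le[OF L1 L2]) (use L3 in auto)
  then show ?thesis by (simp add: H_def set_lebesgue_integral_def abs_mult)
qed


section \<open>Differentiability of weakly differentiable functions\<close>

lemma integrable_mult_bounded:
  fixes f g :: "'a \<Rightarrow> real"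
  assumes "integrable M f" "g \<in> borel_measurable M" "\<And>z. \<bar>g z\<bar> \<le> K"
  shows "integrable M (\<lambda>z. f z * g z)"
proof (rule Bochner_Integration.integrable_bound[where f = "\<lambda>z. f z * K"])
  have "norm (f z * g z) \<le> norm (f z * K)" for z
    using assms(3)[of z] by (auto simp: abs_mult intro!: mult_left_mono)
  then show "AE z in M. norm (f z * g z) \<le> norm (f z * K)" by simp
qed (use assms in auto)

lemma continuous_compact_support_bounded:
  fixes f :: "'a::topological_space \<Rightarrow> real"
  assumes "continuous_on UNIV f" "compact S" "\<And>z. z \<notin> S \<Longrightarrow> f z = 0"
  obtains B where "\<And>z. \<bar>f z\<bar> \<le> B" "0 \<le> B"
proof -
  have "compact (f ` S)"
    using assms by (intro compact_continuous_image continuous_on_subset[OF assms(1)]) auto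
  then obtain b where b: "\<And>y. y \<in> f ` S \<Longrightarrow> norm y \<le> b"
    using compact_imp_bounded bounded_iff by metis
  show thesis
  proof (rule that[of "max 0 b"])
    fix z show "\<bar>f z\<bar> \<le> max 0 b"
      using b[of "f z"] assms(3)[of z] by (cases "z \<in> S") (auto intro: max.coboundedI2)
  qed simp
qed

lemma continuous_compact_support_integrable:
  fixes f :: "'a::euclidean_space \<Rightarrow> real"
  assumes "continuous_on UNIV f" "compact S" "\<And>z. z \<notin> S \<Longrightarrow> f z = 0"
  shows "integrable lebesgue f"
proof -
  obtain B where B: "\<And>z. \<bar>f z\<bar> \<le> B"
    using continuous_compact_support_bounded[OF assms] by metis
  have S: "S \<in> lmeasurable" by (rule lmeasurable_compact) (rule assms)
  have m: "f \<in> borel_measurable lebesgue"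
    by (rule measurable_completion) (simp add: borel_measurable_continuous_onI assms)
  have "integrable lebesgue (\<lambda>z. indicat_real S z * f z)"
    using S by (intro integrable_mult_bounded[OF _ m B] integrable_real_indicator) (auto simp: fmeasurable_def)
  moreover have "(\<lambda>z. indicat_real S z * f z) = f"
    by (rule ext) (use assms(3) in \<open>auto simp: indicator_def\<close>)
  ultimately show ?thesis by simp
qed

lemma rescale_mem_unit_cball:
  fixes x :: "'a::real_normed_vector"
  assumes "s > 0"
  shows "(z - x) /\<^sub>R s \<in> cball 0 1 \<longleftrightarrow> z \<in> cball x s"
proof -
  have "norm ((z - x) /\<^sub>R s) = norm (z - x) / s"
    using assms by (simp only: norm_scaleR abs_inverse abs_of_pos divide_inverse mult.commute)
  then show ?thesis
    using assms by (simp add: dist_norm norm_minus_commute pos_divide_le_eq del: norm_scaleR)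
qed

lemma integral_rescale:
  fixes f :: "'a::euclidean_space \<Rightarrow> real"
  assumes f: "continuous_on UNIV f" "\<And>z. z \<notin> cball 0 1 \<Longrightarrow> f z = 0" and s: "s > 0"
  shows "(\<integral>z. f ((z - x) /\<^sub>R s) \<partial>lebesgue) = s ^ DIM('a) * (\<integral>w. f w \<partial>lebesgue)"
proof -
  have c: "continuous_on UNIV (\<lambda>z. f ((z - x) /\<^sub>R s))"
    using s by (intro continuous_on_compose2[OF f(1)] continuous_intros) auto
  have "f ((z - x) /\<^sub>R s) = 0" if "z \<notin> cball x s" for z
    using that rescale_mem_unit_cball[OF s, of z x] by (intro f(2)) simp
  then have i: "integrable lebesgue (\<lambda>z. f ((z - x) /\<^sub>R s))"
    by (rule continuous_compact_support_integrable[OF c compact_cball])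
  have T: "x + (\<Sum>j\<in>Basis. (s * (z \<bullet> j)) *\<^sub>R j) = x + s *\<^sub>R z" for z
    by (simp add: euclidean_representation flip: scaleR_scaleR scaleR_sum_right)
  show ?thesis
    using lebesgue_integral_diagonal_affine(2)[of "\<lambda>_. s", OF _ i, of x] s by (simp add: T)
qed

text \<open>The mean value theorem bounds the difference quotients by the majorant \<open>w\<close>
  of the derivatives, so dominated convergence applies along every sequence tending to
  \<open>s\<close>.\<close>

lemma has_real_derivative_integral:
  fixes f :: "real \<Rightarrow> 'a \<Rightarrow> real"
  assumes s: "a < s" "s < b" and int: "\<And>t. t \<in> {a<..<b} \<Longrightarrow> integrable M (f t)"
    and deriv: "\<And>t z. t \<in> {a<..<b} \<Longrightarrow> ((\<lambda>t. f t z) has_real_derivative f' t z) (at t)"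
    and bnd: "\<And>t z. t \<in> {a<..<b} \<Longrightarrow> \<bar>f' t z\<bar> \<le> w z" and w: "integrable M w"
    and meas: "f' s \<in> borel_measurable M"
  shows "((\<lambda>t. \<integral>z. f t z \<partial>M) has_real_derivative (\<integral>z. f' s z \<partial>M)) (at s)"
  unfolding has_field_derivative_iff tendsto_at_iff_sequentially
proof (intro allI impI)
  fix X assume X: "\<forall>i. X i \<in> UNIV - {s}" "X \<longlonglongrightarrow> s"
  then have "eventually (\<lambda>n. X n \<in> {a<..<b}) sequentially"
    by (rule_tac topological_tendstoD) (use s in auto)
  then obtain N where N: "\<And>n. n \<ge> N \<Longrightarrow> X n \<in> {a<..<b}"
    unfolding eventually_sequentially by blast
  define Y where "Y = (\<lambda>n. X (n + N))"
  have Y: "Y n \<in> {a<..<b}" "Y n \<noteq> s" for n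
    using N[of "n + N"] X(1) unfolding Y_def by auto
  have Yl: "Y \<longlonglongrightarrow> s" unfolding Y_def using X(2) by (rule LIMSEQ_ignore_initial_segment)
  have "(\<lambda>n. \<integral>z. (f (Y n) z - f s z) / (Y n - s) \<partial>M) \<longlonglongrightarrow> (\<integral>z. f' s z \<partial>M)"
  proof (rule integral_dominated_convergence[OF meas _ w])
    show "(\<lambda>z. (f (Y n) z - f s z) / (Y n - s)) \<in> borel_measurable M" for n
      using int[OF Y(1)[of n]] int[of s] s by auto
    have "(\<lambda>n. (f (Y n) z - f s z) / (Y n - s)) \<longlonglongrightarrow> f' s z" for z
    proof -
      have "((\<lambda>t. f t z) has_real_derivative f' s z) (at s)" using deriv s by simp
      then have "((\<lambda>t. (f t z - f s z) / (t - s)) \<longlongrightarrow> f' s z) (at s)"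
        unfolding has_field_derivative_iff .
      then show ?thesis
        unfolding tendsto_at_iff_sequentially using Y(2) Yl by (auto simp: o_def)
    qed
    then show "AE z in M. (\<lambda>n. (f (Y n) z - f s z) / (Y n - s)) \<longlonglongrightarrow> f' s z" by simp
    have "norm ((f (Y n) z - f s z) / (Y n - s)) \<le> w z" for n z
    proof -
      have "norm (f (Y n) z - f s z) \<le> w z * norm (Y n - s)"
        by (rule field_differentiable_bound[where S = "{a<..<b}" and f = "\<lambda>t. f t z" and f' = "\<lambda>t. f' t z"])
          (use Y s bnd deriv in \<open>auto intro: has_field_derivative_at_within\<close>)
      then show ?thesis using Y(2)[of n] by (simp add: field_simps abs_divide)
    qed
    then show "AE z in M. norm ((f (Y n) z - f s z) / (Y n - s)) \<le> w z" for n by simp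
  qed
  moreover have "(\<integral>z. (f (Y n) z - f s z) / (Y n - s) \<partial>M) = ((\<integral>z. f (Y n) z \<partial>M) - (\<integral>z. f s z \<partial>M)) / (Y n - s)" for n
    using int[OF Y(1)[of n]] int[of s] s by simp
  ultimately have "(\<lambda>n. ((\<integral>z. f (Y n) z \<partial>M) - (\<integral>z. f s z \<partial>M)) / (Y n - s)) \<longlonglongrightarrow> (\<integral>z. f' s z \<partial>M)"
    by (simp only:)
  then have "(\<lambda>n. (((\<lambda>t. ((\<integral>z. f t z \<partial>M) - (\<integral>z. f s z \<partial>M)) / (t - s)) \<circ> X) (n + N))) \<longlonglongrightarrow> (\<integral>z. f' s z \<partial>M)"
    unfolding Y_def o_def .
  then show "((\<lambda>t. ((\<integral>z. f t z \<partial>M) - (\<integral>z. f s z \<partial>M)) / (t - s)) \<circ> X) \<longlonglongrightarrow> (\<integral>z. f' s z \<partial>M)"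
    by (rule LIMSEQ_offset)
qed

section \<open>Dilations of test functions\<close>

lemma C1_on_frechet_apply_continuous:
  assumes f: "C1_on S f" and v: "continuous_on S v"
  shows "continuous_on S (\<lambda>x. frechet_derivative f (at x) (v x))"
proof -
  have "continuous_on S (\<lambda>x. blinfun_apply (Blinfun (frechet_derivative f (at x))) (v x))"
    using C1_on_frechet[OF f] v by (intro continuous_intros)
  moreover have "blinfun_apply (Blinfun (frechet_derivative f (at x))) (v x) = frechet_derivative f (at x) (v x)"
    if "x \<in> S" for x
    using C1_on_has_derivative[OF f that]
    by (simp add: bounded_linear_Blinfun_apply has_derivative_bounded_linear)
  ultimately show ?thesis by (simp cong: continuous_on_cong)
qed

lemma frechet_derivative_outside_support:
  assumes "closed S" "\<And>z. z \<notin> S \<Longrightarrow> f z = 0" "w \<notin> S"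
  shows "frechet_derivative f (at w) = (\<lambda>_. 0)"
proof -
  have "(f has_derivative (\<lambda>_. 0)) (at w)"
    by (rule has_derivative_transform_within_open[OF has_derivative_const[of 0] open_Compl[OF assms(1)]])
      (use assms in auto)
  then show ?thesis using frechet_derivative_at by metis
qed

text \<open>
  \<^term>\<open>\<lambda>z. dilation_deriv \<eta> ((z - x) /\<^sub>R s)\<close> is \<open>s\<close> times the divergence of the
  field \<^term>\<open>\<lambda>z. \<eta> ((z - x) /\<^sub>R s) *\<^sub>R ((z - x) /\<^sub>R s)\<close>, and it is also
  \<open>- s ^ (m + 1)\<close> times the derivative in \<open>s\<close> of the rescaled kernel
  \<^term>\<open>\<lambda>z. \<eta> ((z - x) /\<^sub>R s) / s ^ m\<close>.
\<close>

definition dilation_deriv :: "('a::euclidean_space \<Rightarrow> real) \<Rightarrow> 'a \<Rightarrow> real" where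
  "dilation_deriv \<eta> w = real DIM('a) * \<eta> w + frechet_derivative \<eta> (at w) w"

lemma dilation_deriv_kernel:
  fixes \<eta> :: "'a::euclidean_space \<Rightarrow> real"
  assumes \<eta>: "C1_on UNIV \<eta>" and t: "t > 0"
  shows "((\<lambda>t. \<eta> (y /\<^sub>R t) / t ^ DIM('a)) has_real_derivative
     - dilation_deriv \<eta> (y /\<^sub>R t) / t ^ (DIM('a) + 1)) (at t)"
proof -
  define w where "w = y /\<^sub>R t"
  define D where "D = - (1/t) * frechet_derivative \<eta> (at w) w"
  have d: "(\<eta> has_derivative frechet_derivative \<eta> (at w)) (at w)"
    using C1_on_has_derivative[OF \<eta>] by simp
  have l: "linear (frechet_derivative \<eta> (at w))"
    using d has_derivative_linear by blast
  have "((\<lambda>t. y /\<^sub>R t) has_derivative (\<lambda>h. h *\<^sub>R (- (1/t) *\<^sub>R w))) (at t)"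
    unfolding w_def using t by (auto intro!: derivative_eq_intros simp: power2_eq_square divide_simps)
  from diff_chain_at[OF this d[unfolded w_def]]
  have "((\<lambda>t. \<eta> (y /\<^sub>R t)) has_derivative (\<lambda>h. frechet_derivative \<eta> (at w) (h *\<^sub>R (- (1/t) *\<^sub>R w)))) (at t)"
    by (simp only: o_def w_def)
  moreover have "frechet_derivative \<eta> (at w) (h *\<^sub>R (- (1/t) *\<^sub>R w)) = D * h" for h
    unfolding D_def linear_cmul[OF l] by simp
  ultimately have 1: "((\<lambda>t. \<eta> (y /\<^sub>R t)) has_real_derivative D) (at t)"
    by (simp only: has_field_derivative_def)
  have 2: "((\<lambda>t. t ^ DIM('a)) has_real_derivative (real DIM('a) * t ^ (DIM('a) - 1))) (at t)"
    by (auto intro!: derivative_eq_intros)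
  have p: "t ^ DIM('a) = t * t ^ (DIM('a) - 1)"
    using DIM_positive[where 'a = 'a] by (metis power_eq_if nat_less_le)
  have "((\<lambda>t. \<eta> (y /\<^sub>R t) / t ^ DIM('a)) has_real_derivative
      (D * t ^ DIM('a) - \<eta> (y /\<^sub>R t) * (real DIM('a) * t ^ (DIM('a) - 1)))
        / (t ^ DIM('a) * t ^ DIM('a))) (at t)"
    using t by (intro DERIV_divide 1 2) auto
  moreover have "(D * t ^ DIM('a) - \<eta> w * (real DIM('a) * t ^ (DIM('a) - 1)))
        / (t ^ DIM('a) * t ^ DIM('a)) = - dilation_deriv \<eta> w / t ^ (DIM('a) + 1)"
    using t unfolding dilation_deriv_def D_def p by (simp add: divide_simps) (simp add: algebra_simps p)
  ultimately show ?thesis unfolding w_def by (simp only:)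
qed

lemma dilation_deriv_continuous: "C1_on UNIV \<eta> \<Longrightarrow> continuous_on UNIV (dilation_deriv \<eta>)"
  unfolding dilation_deriv_def
  by (intro continuous_intros C1_on_imp_continuous_on C1_on_frechet_apply_continuous)

lemma dilation_deriv_support:
  assumes "\<And>w. w \<notin> cball 0 1 \<Longrightarrow> \<eta> w = 0" "w \<notin> cball 0 1"
  shows "dilation_deriv \<eta> w = 0"
  using frechet_derivative_outside_support[OF closed_cball assms(1) assms(2)] assms
  by (simp add: dilation_deriv_def)

lemma C1_on_rescale:
  fixes x :: "'a::real_normed_vector"
  shows "C1_on S (\<lambda>z. (z - x) /\<^sub>R s)"
proof -
  have "C1_on S (\<lambda>z. z /\<^sub>R s + (- (x /\<^sub>R s)))"
    by (intro C1_on_add C1_on_const C1_on_bounded_linear bounded_linear_scaleR_right)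
  then show ?thesis by (simp add: scaleR_diff_right)
qed

lemma linear_vec_sum:
  fixes f :: "real ^ 'm::finite \<Rightarrow> real"
  assumes "linear f"
  shows "(\<Sum>i\<in>UNIV. f (axis i 1) * w $ i) = f w"
proof -
  have "f w = f (\<Sum>i\<in>UNIV. w $ i *\<^sub>R axis i 1)"
    using basis_expansion[of w] by (simp add: scalar_mult_eq_scaleR)
  also have "\<dots> = (\<Sum>i\<in>UNIV. w $ i * f (axis i 1))"
    using assms by (simp add: linear_sum linear_cmul)
  finally show ?thesis by (simp add: mult.commute)
qed

lemma compact_closure_support:
  assumes "compact S" "\<And>z. z \<notin> S \<Longrightarrow> f z = 0"
  shows "compact (closure {z::'a::t2_space. f z \<noteq> (0::real)})" "closure {z. f z \<noteq> 0} \<subseteq> S"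
proof -
  show "closure {z. f z \<noteq> 0} \<subseteq> S"
    using assms by (intro closure_minimal compact_imp_closed) auto
  then have "S \<inter> closure {z. f z \<noteq> 0} = closure {z. f z \<noteq> 0}" by blast
  then show "compact (closure {z. f z \<noteq> 0})"
    using compact_Int_closed[OF assms(1) closed_closure, of "{z. f z \<noteq> 0}"] by simp
qed

lemma has_weak_derivative_onD:
  assumes "has_weak_derivative_on g G \<Omega>"
  shows "locally_integrable_on g \<Omega>" "z \<in> \<Omega> \<Longrightarrow> linear (G z)" "locally_integrable_on (\<lambda>z. G z v) \<Omega>"
    "test_function \<Omega> \<phi> \<Longrightarrow> (LINT z:\<Omega>|lebesgue. g z * frechet_derivative \<phi> (at z) v) =
        - (LINT z:\<Omega>|lebesgue. G z v * \<phi> z)"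
  using assms unfolding has_weak_derivative_on_def by simp_all

lemma locally_integrable_onD:
  assumes "locally_integrable_on g \<Omega>" "compact S" "S \<subseteq> \<Omega>"
  shows "integrable lebesgue (\<lambda>z. indicator S z * g z)"
proof -
  have "set_integrable lebesgue S g"
    using assms unfolding locally_integrable_on_def by simp
  then show ?thesis unfolding set_integrable_def by simp
qed

text \<open>Testing in the direction \<open>axis i 1\<close> with the component \<open>X i\<close>
  of the field \<open>\<eta> (w z) *\<^sub>R w z\<close> and summing over \<open>i\<close> produces
  the divergence \<open>dilation_deriv \<eta> (w z) / s\<close> on one side and, by linearity of
  \<open>G z\<close>, the value \<open>G z (w z) * \<eta> (w z)\<close> on the other. The compact
  \<open>S\<close> stands in for \<open>\<Omega>\<close>, on which \<open>g\<close> is only locally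
  integrable; it can be kept fixed while \<open>s\<close> varies.\<close>

lemma dilation_identity:
  fixes g :: "real ^ 'm::finite \<Rightarrow> real"
  assumes gG: "has_weak_derivative_on g G \<Omega>" and S: "compact S" "S \<subseteq> \<Omega>" "cball x s \<subseteq> S" and s: "s > 0"
    and \<eta>: "C1_on UNIV \<eta>" "\<And>w. w \<notin> cball 0 1 \<Longrightarrow> \<eta> w = 0"
  defines "w \<equiv> (\<lambda>z. (z - x) /\<^sub>R s)"
  shows "integrable lebesgue (\<lambda>z. indicator S z * (G z (w z) * \<eta> (w z)))"
    and "(\<integral>z. indicator S z * g z * dilation_deriv \<eta> (w z) \<partial>lebesgue) =
      - s * (\<integral>z. indicator S z * (G z (w z) * \<eta> (w z)) \<partial>lebesgue)"
proof -
  note gi = locally_integrable_onD[OF has_weak_derivative_onD(1)[OF gG] S(1,2)]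
  note Gi = locally_integrable_onD[OF has_weak_derivative_onD(3)[OF gG] S(1,2)]
  have lin: "linear (G z)" if "z \<in> S" for z
    using has_weak_derivative_onD(2)[OF gG] S(2) that by blast
  note weak = has_weak_derivative_onD(4)[OF gG]
  define X where "X = (\<lambda>i z. \<eta> (w z) * w z $ i)"
  define d where "d = (\<lambda>i z. frechet_derivative (X i) (at z) (axis i 1))"
  have w1: "C1_on UNIV w" unfolding w_def by (rule C1_on_rescale)
  have X1: "C1_on UNIV (X i)" for i
    unfolding X_def
    by (intro C1_on_mult C1_on_compose[OF w1 \<eta>(1)] C1_on_compose[OF w1 C1_on_bounded_linear] bounded_linear_vec_nth) auto
  have X0: "X i z = 0" if "z \<notin> cball x s" for i z
    using \<eta>(2)[of "w z"] rescale_mem_unit_cball[OF s, of z x] that by (simp add: X_def w_def)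
  have test: "test_function \<Omega> (X i)" for i
    unfolding test_function_def
    using X1 compact_closure_support[of "cball x s" "X i", OF compact_cball X0] S by blast
  have d0: "d i z = 0" if "z \<notin> cball x s" for i z
    using frechet_derivative_outside_support[OF closed_cball X0 that] by (simp add: d_def)
  have dc: "continuous_on UNIV (d i)" for i
    unfolding d_def by (intro C1_on_frechet_apply_continuous X1 continuous_intros)
  have d: "d i z = (frechet_derivative \<eta> (at (w z)) (axis i 1) * w z $ i + \<eta> (w z)) / s" for i z
  proof -
    have e: "(\<eta> has_derivative frechet_derivative \<eta> (at (w z))) (at (w z))"
      using C1_on_has_derivative[OF \<eta>(1)] by simp
    have l: "linear (frechet_derivative \<eta> (at (w z)))"
      using e has_derivative_linear by blast
    have dw: "(w has_derivative (\<lambda>h. h /\<^sub>R s)) (at z)"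
      unfolding w_def by (auto intro!: derivative_eq_intros)
    have 1: "((\<lambda>z. \<eta> (w z)) has_derivative (\<lambda>h. frechet_derivative \<eta> (at (w z)) (h /\<^sub>R s))) (at z)"
      using diff_chain_at[OF dw e] by (simp add: o_def)
    have 2: "((\<lambda>z. w z $ i) has_derivative (\<lambda>h. (h /\<^sub>R s) $ i)) (at z)"
      using bounded_linear.has_derivative[OF bounded_linear_vec_nth dw] .
    have "(X i has_derivative (\<lambda>h. \<eta> (w z) * (h /\<^sub>R s) $ i +
        frechet_derivative \<eta> (at (w z)) (h /\<^sub>R s) * w z $ i)) (at z)"
      unfolding X_def by (rule has_derivative_mult[OF 1 2])
    from fun_cong[OF frechet_derivative_at[OF this], of "axis i 1"] have "d i z = \<eta> (w z) * (axis i 1 /\<^sub>R s) $ i +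
        frechet_derivative \<eta> (at (w z)) (axis i 1 /\<^sub>R s) * w z $ i"
      by (simp only: d_def)
    moreover have "frechet_derivative \<eta> (at (w z)) (axis i 1 /\<^sub>R s) =
        frechet_derivative \<eta> (at (w z)) (axis i 1) / s"
      by (simp add: linear_cmul[OF l] divide_inverse mult.commute)
    moreover have "(axis i 1 /\<^sub>R s) $ i = 1 / s" by (simp add: divide_inverse)
    ultimately show ?thesis by (simp add: add_divide_distrib)
  qed
  have dsum: "(\<Sum>i\<in>UNIV. d i z) = dilation_deriv \<eta> (w z) / s" for z
  proof -
    have "linear (frechet_derivative \<eta> (at (w z)))"
      using C1_on_has_derivative[OF \<eta>(1)] has_derivative_linear by blast
    then show ?thesis
      unfolding d dilation_deriv_def
      by (simp add: linear_vec_sum sum.distrib flip: sum_divide_distrib)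
  qed
  have id: "integrable lebesgue (\<lambda>z. indicator S z * g z * d i z)" for i
  proof -
    obtain B where "\<And>z. \<bar>d i z\<bar> \<le> B"
      using continuous_compact_support_bounded[OF dc compact_cball d0] by metis
    then show ?thesis
      by (intro integrable_mult_bounded[OF gi])
        (auto intro!: measurable_completion borel_measurable_continuous_onI dc)
  qed
  have iX: "integrable lebesgue (\<lambda>z. indicator S z * G z (axis i 1) * X i z)" for i
  proof -
    obtain B where "\<And>z. \<bar>X i z\<bar> \<le> B"
      using continuous_compact_support_bounded[OF C1_on_imp_continuous_on[OF X1] compact_cball X0] by metis
    then show ?thesis
      by (intro integrable_mult_bounded[OF Gi] C1_on_borel_measurable_lebesgue X1)
  qed
  have eq: "(\<integral>z. indicator S z * g z * d i z \<partial>lebesgue) = - (\<integral>z. indicator S z * G z (axis i 1) * X i z \<partial>lebesgue)" for i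
  proof -
    have cut: "(\<integral>z. indicator S z * a z * b z \<partial>lebesgue) = (LINT z:\<Omega>|lebesgue. a z * b z)"
      if "\<And>z. z \<notin> cball x s \<Longrightarrow> b z = 0" for a b :: "real ^ 'm \<Rightarrow> real"
      unfolding set_lebesgue_integral_def
    proof (rule Bochner_Integration.integral_cong[OF refl])
      fix z show "indicat_real S z * a z * b z = indicat_real \<Omega> z *\<^sub>R (a z * b z)"
      proof (cases "z \<in> cball x s")
        case True
        then have "z \<in> S" "z \<in> \<Omega>" using S by blast+
        then show ?thesis by simp
      qed (simp add: that)
    qed
    show ?thesis
    proof -
      have "(\<integral>z. indicator S z * g z * d i z \<partial>lebesgue) = (LINT z:\<Omega>|lebesgue. g z * d i z)"
        by (rule cut) (rule d0)
      also have "\<dots> = - (LINT z:\<Omega>|lebesgue. G z (axis i 1) * X i z)"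
        unfolding d_def by (rule weak[OF test])
      also have "(LINT z:\<Omega>|lebesgue. G z (axis i 1) * X i z) = (\<integral>z. indicator S z * G z (axis i 1) * X i z \<partial>lebesgue)"
        by (rule cut[symmetric]) (rule X0)
      finally show ?thesis .
    qed
  qed
  have Gsum: "(\<Sum>i\<in>UNIV. indicat_real S z * G z (axis i 1) * X i z) = indicator S z * (G z (w z) * \<eta> (w z))" for z
  proof (cases "z \<in> S")
    case True
    then show ?thesis
      unfolding X_def
      by (subst linear_vec_sum[OF lin[OF True], of "w z", symmetric])
        (simp add: sum_distrib_left sum_distrib_right mult_ac)
  qed simp
  show "integrable lebesgue (\<lambda>z. indicator S z * (G z (w z) * \<eta> (w z)))"
    unfolding Gsum[symmetric] by (intro Bochner_Integration.integrable_sum iX)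
  have "indicat_real S z * g z * dilation_deriv \<eta> (w z) = s * (\<Sum>i\<in>UNIV. indicator S z * g z * d i z)" for z
    using s by (simp add: dsum flip: sum_distrib_left)
  then have "(\<integral>z. indicator S z * g z * dilation_deriv \<eta> (w z) \<partial>lebesgue) =
      s * (\<Sum>i\<in>UNIV. \<integral>z. indicator S z * g z * d i z \<partial>lebesgue)"
    using id by simp
  also have "\<dots> = - s * (\<Sum>i\<in>UNIV. \<integral>z. indicator S z * G z (axis i 1) * X i z \<partial>lebesgue)"
    by (simp add: eq sum_negf)
  also have "(\<Sum>i\<in>UNIV. \<integral>z. indicator S z * G z (axis i 1) * X i z \<partial>lebesgue) =
      (\<integral>z. indicator S z * (G z (w z) * \<eta> (w z)) \<partial>lebesgue)"
    unfolding Gsum[symmetric] by (rule Bochner_Integration.integral_sum[symmetric]) (rule iX)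
  finally show "(\<integral>z. indicator S z * g z * dilation_deriv \<eta> (w z) \<partial>lebesgue) =
      - s * (\<integral>z. indicator S z * (G z (w z) * \<eta> (w z)) \<partial>lebesgue)" .
qed


text \<open>
  Only the part of the integral that contains \<open>g\<close> uses the weak derivative; the affine part
  is evaluated by rescaling, so that no divergence theorem is needed.
\<close>

lemma weak_derivative_test_bound:
  fixes g :: "real ^ 'm::finite \<Rightarrow> real"
  assumes gG: "has_weak_derivative_on g G \<Omega>" and R: "cball x R \<subseteq> \<Omega>" and r: "0 < r" "r < R"
    and W: "\<And>s. 0 < s \<Longrightarrow> s \<le> r \<Longrightarrow>
      (LINT z:cball x s|lebesgue. (\<Sum>i\<in>UNIV. \<bar>G z (axis i 1) - G x (axis i 1)\<bar>)) \<le> \<kappa> * s ^ CARD('m)"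
    and L: "\<And>e. e > 0 \<Longrightarrow> \<exists>d>0. \<forall>s. 0 < s \<and> s < d \<longrightarrow>
      (LINT z:cball x s|lebesgue. \<bar>g z - g x\<bar>) \<le> e * s ^ CARD('m)"
    and \<eta>: "C1_on UNIV \<eta>" "\<And>w. w \<notin> cball 0 1 \<Longrightarrow> \<eta> w = 0" and K: "\<And>w. \<bar>\<eta> w\<bar> \<le> K"
  shows "(\<integral>z. indicator (cball x R) z * (g z - g x - G x (z - x)) * \<eta> ((z - x) /\<^sub>R r) \<partial>lebesgue)
    \<le> K * \<kappa> * r ^ (CARD('m) + 1)"
proof -
  let ?m = "CARD('m)"
  define S where "S = cball x R"
  define w where "w = (\<lambda>s z. (z - x) /\<^sub>R s)"
  have S: "compact S" "S \<subseteq> \<Omega>" "\<And>s. s \<le> r \<Longrightarrow> cball x s \<subseteq> S"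
    using R r by (auto simp: S_def)
  have x: "x \<in> S" using r by (simp add: S_def)
  have iS: "integrable lebesgue (indicat_real S)"
    using lmeasurable_compact[OF S(1)] by (intro integrable_real_indicator) (auto simp: fmeasurable_def)
  have lin: "linear (G z)" if "z \<in> S" for z
    using has_weak_derivative_onD(2)[OF gG] S(2) that by blast
  note gi = locally_integrable_onD[OF has_weak_derivative_onD(1)[OF gG] S(1,2)]
  note Gi = locally_integrable_onD[OF has_weak_derivative_onD(3)[OF gG] S(1,2)]
  have dil: "integrable lebesgue (\<lambda>z. indicator S z * (G z (w s z) * \<eta> (w s z)))"
      "(\<integral>z. indicator S z * g z * dilation_deriv \<eta> (w s z) \<partial>lebesgue) =
        - s * (\<integral>z. indicator S z * (G z (w s z) * \<eta> (w s z)) \<partial>lebesgue)" if "0 < s" "s \<le> r" for s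
    unfolding w_def
    using dilation_identity[OF gG S(1,2) S(3)[OF that(2)] that(1) \<eta>(1)] \<eta>(2) by simp_all
  have \<eta>c: "continuous_on UNIV \<eta>" by (rule C1_on_imp_continuous_on[OF \<eta>(1)])
  have Gxc: "continuous_on UNIV (G x)"
    using lin[OF x] by (simp add: linear_continuous_on linear_conv_bounded_linear)
  have \<eta>w0: "\<eta> (w s z) = 0" if "s > 0" "z \<notin> cball x s" for s z
    using \<eta>(2)[of "w s z"] rescale_mem_unit_cball[OF that(1), of z x] that(2) by (simp add: w_def)
  have \<eta>wm: "(\<lambda>z. \<eta> (w s z)) \<in> borel_measurable lebesgue" for s
    unfolding w_def by (intro C1_on_borel_measurable_lebesgue C1_on_compose[OF C1_on_rescale \<eta>(1)]) auto
  have K0: "K \<ge> 0" using K[of 0] by linarith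
  \<comment> \<open>By rescaling, the affine function \<open>g x + G x (z - x)\<close> integrated
    against the kernel of scale \<open>t\<close> is exactly \<open>g x * I0 + t * I1\<close>, whose
    derivative in \<open>t\<close> is \<open>I1\<close>.\<close>
  define I0 where "I0 = (\<integral>w. \<eta> w \<partial>lebesgue)"
  define I1 where "I1 = (\<integral>w. G x w * \<eta> w \<partial>lebesgue)"
  have I0: "(\<integral>z. \<eta> (w s z) \<partial>lebesgue) = s ^ ?m * I0" if "s > 0" for s
    unfolding w_def I0_def using integral_rescale[OF \<eta>c \<eta>(2) that, of x] by simp
  have I1: "(\<integral>z. G x (w s z) * \<eta> (w s z) \<partial>lebesgue) = s ^ ?m * I1" if "s > 0" for s
    unfolding w_def I1_def
    using integral_rescale[of "\<lambda>w. G x w * \<eta> w", OF continuous_on_mult[OF Gxc \<eta>c] _ that, of x] \<eta>(2) by simp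
  have cut: "indicator S z * a * \<eta> (w s z) = a * \<eta> (w s z)" if "0 < s" "s \<le> r" for a s z
    using \<eta>w0[OF that(1), of z] S(3)[OF that(2)] by (cases "z \<in> cball x s") (auto simp: indicator_def)
  have i\<eta>: "integrable lebesgue (\<lambda>z. \<eta> (w s z))" if "s > 0" for s
    by (rule continuous_compact_support_integrable[OF _ compact_cball \<eta>w0[OF that]])
      (auto simp: w_def intro!: C1_on_imp_continuous_on C1_on_compose[OF C1_on_rescale \<eta>(1)])
  have iG\<eta>: "integrable lebesgue (\<lambda>z. G x (w s z) * \<eta> (w s z))" if "s > 0" for s
  proof (rule continuous_compact_support_integrable[OF _ compact_cball])
    show "continuous_on UNIV (\<lambda>z. G x (w s z) * \<eta> (w s z))"
      unfolding w_def
      by (intro continuous_on_mult continuous_on_compose2[OF Gxc] continuous_on_compose2[OF \<eta>c]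
           C1_on_imp_continuous_on[OF C1_on_rescale]) auto
    show "G x (w s z) * \<eta> (w s z) = 0" if "z \<notin> cball x s" for z
      using \<eta>w0[OF \<open>s > 0\<close> that] by simp
  qed
  have ig\<eta>: "integrable lebesgue (\<lambda>z. indicator S z * g z * \<eta> (w s z))" for s
    by (rule integrable_mult_bounded[OF gi \<eta>wm K])
  \<comment> \<open>\<open>F\<close> is the integral of \<open>g\<close> against the kernel,
    \<open>D\<close> that of the remainder, and \<open>A\<close> will turn out to be the derivative
    of \<open>D\<close>: the mean of \<open>(G z - G x) (w s z) * \<eta> (w s z)\<close> with the
    normalisation \<open>s ^ m\<close>.\<close>
  define F where "F = (\<lambda>t. \<integral>z. indicator S z * g z * (\<eta> (w t z) / t ^ ?m) \<partial>lebesgue)"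
  define D where "D = (\<lambda>t. F t - (g x * I0 + t * I1))"
  define A where "A = (\<lambda>s. (\<integral>z. indicator S z * (G z (w s z) * \<eta> (w s z)) \<partial>lebesgue) / s ^ ?m - I1)"
  have dc: "continuous_on UNIV (dilation_deriv \<eta>)" using \<eta>(1) by (rule dilation_deriv_continuous)
  obtain C where C: "\<And>w. \<bar>dilation_deriv \<eta> w\<bar> \<le> C" "C \<ge> 0"
    using continuous_compact_support_bounded[OF dc compact_cball dilation_deriv_support[OF \<eta>(2)]] by metis
  have DA: "(D has_real_derivative A s) (at s)" if s: "0 < s" "s \<le> r" for s
  proof -
    let ?f' = "\<lambda>t z. indicator S z * g z * (- dilation_deriv \<eta> (w t z) / t ^ (?m + 1))"
    let ?b = "C / (s/2) ^ (?m + 1)"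
    have "(F has_real_derivative (\<integral>z. ?f' s z \<partial>lebesgue)) (at s)"
      unfolding F_def
    \<comment> \<open>The interval keeps \<open>t\<close> away from \<open>0\<close>, so that a
      power of \<open>s / 2\<close> bounds the denominators. It may reach beyond \<open>r\<close>,
      which is harmless: the domain \<open>S\<close> does not depend on \<open>t\<close>, and
      \<open>dil\<close> is applied at \<open>s\<close> only.\<close>
    proof (rule has_real_derivative_integral[where a = "s/2" and b = "2 * s" and w = "\<lambda>z. \<bar>indicator S z * g z\<bar> * ?b"])
      show "integrable lebesgue (\<lambda>z. indicator S z * g z * (\<eta> (w t z) / t ^ ?m))" for t
      proof -
        have "integrable lebesgue (\<lambda>z. indicator S z * g z * \<eta> (w t z) / t ^ ?m)"
          by (intro integrable_divide ig\<eta>)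
        then show ?thesis by simp
      qed
      show "((\<lambda>t. indicator S z * g z * (\<eta> (w t z) / t ^ ?m)) has_real_derivative ?f' t z) (at t)"
        if "t \<in> {s/2<..<2 * s}" for t z
        using dilation_deriv_kernel[OF \<eta>(1), of t "z - x"] that s unfolding w_def
        by (intro DERIV_cmult) simp
      show "\<bar>?f' t z\<bar> \<le> \<bar>indicator S z * g z\<bar> * ?b" if t: "t \<in> {s/2<..<2 * s}" for t z
      proof -
        have "\<bar>- dilation_deriv \<eta> (w t z) / t ^ (?m + 1)\<bar> = \<bar>dilation_deriv \<eta> (w t z)\<bar> / t ^ (?m + 1)"
          using t s by (simp add: abs_divide)
        also have "\<dots> \<le> ?b"
          using t s C by (intro frac_le power_mono zero_less_power) auto
        finally show ?thesis
          unfolding abs_mult[of "indicator S z * g z"] by (intro mult_left_mono) auto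
      qed
      show "integrable lebesgue (\<lambda>z. \<bar>indicator S z * g z\<bar> * ?b)"
        using gi by (intro integrable_mult_left integrable_abs) auto
      have "(\<lambda>z. dilation_deriv \<eta> (w s z)) \<in> borel_measurable lebesgue"
        unfolding w_def
        by (rule measurable_completion) (auto intro!: borel_measurable_continuous_onI
            continuous_on_compose2[OF dc] C1_on_imp_continuous_on[OF C1_on_rescale])
      then show "?f' s \<in> borel_measurable lebesgue"
        by (intro borel_measurable_times[OF borel_measurable_integrable[OF gi]]
            borel_measurable_divide borel_measurable_uminus) auto
    qed (use s in auto)
    moreover have "(\<integral>z. ?f' s z \<partial>lebesgue) = (\<integral>z. indicator S z * (G z (w s z) * \<eta> (w s z)) \<partial>lebesgue) / s ^ ?m"
    proof -
      have "(\<integral>z. ?f' s z \<partial>lebesgue) = (\<integral>z. indicator S z * g z * dilation_deriv \<eta> (w s z) * (- 1 / s ^ (?m + 1)) \<partial>lebesgue)"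
        by (rule Bochner_Integration.integral_cong) auto
      also have "\<dots> = (- s * (\<integral>z. indicator S z * (G z (w s z) * \<eta> (w s z)) \<partial>lebesgue)) * (- 1 / s ^ (?m + 1))"
        using dil(2)[OF s] by (simp only: Bochner_Integration.integral_mult_left_zero)
      also have "\<dots> = (\<integral>z. indicator S z * (G z (w s z) * \<eta> (w s z)) \<partial>lebesgue) / s ^ ?m"
        using s by simp
      finally show ?thesis .
    qed
    ultimately have "(F has_real_derivative (A s + I1)) (at s)" by (simp add: A_def)
    then show ?thesis
      unfolding D_def by (auto intro!: derivative_eq_intros)
  qed
  have Ab: "\<bar>A s\<bar> \<le> K * \<kappa>" if s: "0 < s" "s \<le> r" for s
  proof -
    define V where "V = (\<lambda>z. \<Sum>i\<in>UNIV. \<bar>G z (axis i 1) - G x (axis i 1)\<bar>)"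
    have sp: "s ^ ?m > 0" using s by simp
    have iV: "integrable lebesgue (\<lambda>z. indicator (cball x s) z * V z)"
    proof -
      have "integrable lebesgue (\<lambda>z. indicator S z * G z (axis i 1) - indicator S z * G x (axis i 1))" for i
        using iS by (intro Bochner_Integration.integrable_diff Gi integrable_mult_left) auto
      then have "integrable lebesgue (\<lambda>z. \<Sum>i\<in>UNIV. \<bar>indicator S z * G z (axis i 1) - indicator S z * G x (axis i 1)\<bar>)"
        by (intro Bochner_Integration.integrable_sum integrable_abs)
      then have "integrable lebesgue (\<lambda>z. indicator (cball x s) z *\<^sub>R (\<Sum>i\<in>UNIV. \<bar>indicator S z * G z (axis i 1) - indicator S z * G x (axis i 1)\<bar>))"
        by (intro integrable_mult_indicator) auto
      moreover have "indicator (cball x s) z *\<^sub>R (\<Sum>i\<in>UNIV. \<bar>indicator S z * G z (axis i 1) - indicator S z * G x (axis i 1)\<bar>)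
          = indicator (cball x s) z * V z" for z
        using S(3)[OF s(2)] by (cases "z \<in> cball x s") (auto simp: V_def indicator_def)
      ultimately show ?thesis by (simp only:)
    qed
    have "A s * s ^ ?m = (\<integral>z. indicator S z * (G z (w s z) * \<eta> (w s z)) \<partial>lebesgue) - s ^ ?m * I1"
    proof -
      have "(a / s ^ ?m - b) * s ^ ?m = a - s ^ ?m * b" for a b :: real
        using s(1) by (simp add: left_diff_distrib)
      then show ?thesis unfolding A_def .
    qed
    also have "\<dots> = (\<integral>z. indicator S z * (G z (w s z) * \<eta> (w s z)) - G x (w s z) * \<eta> (w s z) \<partial>lebesgue)"
      unfolding I1[OF s(1), symmetric]
      by (rule Bochner_Integration.integral_diff[symmetric]) (intro dil(1) iG\<eta> s)+
    finally have "\<bar>A s * s ^ ?m\<bar> = \<bar>\<integral>z. indicator S z * (G z (w s z) * \<eta> (w s z)) - G x (w s z) * \<eta> (w s z) \<partial>lebesgue\<bar>"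
      by simp
    also have "\<dots> \<le> (\<integral>z. K * (indicator (cball x s) z * V z) \<partial>lebesgue)"
    proof (rule order_trans[OF integral_abs_bound integral_mono])
      show "integrable lebesgue (\<lambda>z. \<bar>indicator S z * (G z (w s z) * \<eta> (w s z)) - G x (w s z) * \<eta> (w s z)\<bar>)"
        by (intro integrable_abs Bochner_Integration.integrable_diff dil(1) iG\<eta> s)
      show "integrable lebesgue (\<lambda>z. K * (indicator (cball x s) z * V z))"
        by (intro integrable_mult_right iV)
      fix z
      show "\<bar>indicator S z * (G z (w s z) * \<eta> (w s z)) - G x (w s z) * \<eta> (w s z)\<bar> \<le> K * (indicator (cball x s) z * V z)"
      proof (cases "z \<in> cball x s")
        case False
        then show ?thesis using \<eta>w0[OF s(1) False] by simp
      next
        case True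
        then have z: "z \<in> S" using S(3)[OF s(2)] by blast
        have "norm (w s z) \<le> 1"
          using rescale_mem_unit_cball[OF s(1), of z x] True by (simp add: w_def)
        then have wi: "\<bar>w s z $ i\<bar> \<le> 1" for i
          using component_le_norm_cart[of "w s z" i] by linarith
        \<comment> \<open>On the ball the coordinates of \<open>w s z\<close> are at most
          \<open>1\<close> in absolute value, so the difference of the two linear forms is bounded
          by its values on the axes, which \<open>W\<close> controls.\<close>
        have "G z (w s z) - G x (w s z) = (\<Sum>i\<in>UNIV. (G z (axis i 1) - G x (axis i 1)) * w s z $ i)"
          by (simp add: left_diff_distrib sum_subtractf linear_vec_sum lin x z)
        also have "\<bar>\<dots>\<bar> \<le> (\<Sum>i\<in>UNIV. \<bar>(G z (axis i 1) - G x (axis i 1)) * w s z $ i\<bar>)" by (rule sum_abs)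
        also have "\<dots> \<le> V z"
          unfolding V_def abs_mult using wi by (intro sum_mono mult_right_le_one_le) auto
        finally have "\<bar>G z (w s z) - G x (w s z)\<bar> * \<bar>\<eta> (w s z)\<bar> \<le> V z * K"
          using K by (intro mult_mono) auto
        then show ?thesis using z True by (simp add: abs_mult[symmetric] algebra_simps)
      qed
    qed
    also have "\<dots> = K * (LINT z:cball x s|lebesgue. V z)" by (simp add: set_lebesgue_integral_def)
    also have "\<dots> \<le> K * (\<kappa> * s ^ ?m)"
      using W[OF s] K0 unfolding V_def by (intro mult_left_mono) auto
    finally have "\<bar>A s\<bar> * s ^ ?m \<le> (K * \<kappa>) * s ^ ?m" using sp by (simp add: abs_mult)
    then show ?thesis using sp by (simp only: mult_le_cancel_right_pos)
  qed
  \<comment> \<open>The sign of \<open>K * \<kappa>\<close> is read off from the bound for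
    \<open>\<bar>A r\<bar>\<close>.\<close>
  have Kk: "K * \<kappa> \<ge> 0" using Ab[of r] r by linarith
  \<comment> \<open>\<open>D\<close> tends to \<open>0\<close> at \<open>0\<close> because
    \<open>x\<close> is a Lebesgue point of \<open>g\<close>; from a small \<open>t\<close> on, the
    mean value theorem on \<open>[t, r]\<close> takes over. One half of \<open>e\<close> is for
    \<open>F t - g x * I0\<close>, the other for \<open>t * I1\<close>. Adding \<open>1\<close> in
    the denominators covers \<open>K = 0\<close> and \<open>I1 = 0\<close>.\<close>
  have Db: "D r \<le> K * \<kappa> * r + e" if e: "e > 0" for e
  proof -
    define e' where "e' = e / (2 * (K + 1))"
    have e': "e' > 0" "K * e' \<le> e / 2" using e K0 by (auto simp: e'_def field_simps)
    obtain d where d: "d > 0" "\<And>s. 0 < s \<and> s < d \<longrightarrow> (LINT z:cball x s|lebesgue. \<bar>g z - g x\<bar>) \<le> e' * s ^ ?m"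
      using L[OF e'(1)] by blast
    define t where "t = min (d / 2) (min r (e / (2 * (\<bar>I1\<bar> + 1))))"
    have t: "0 < t" "t < d" "t \<le> r" "t * (\<bar>I1\<bar> + 1) \<le> e / 2"
    proof -
      show "0 < t" "t < d" "t \<le> r" using d(1) r e by (auto simp: t_def)
      have "t \<le> e / (2 * (\<bar>I1\<bar> + 1))" by (simp add: t_def)
      then have "t * (\<bar>I1\<bar> + 1) \<le> e / (2 * (\<bar>I1\<bar> + 1)) * (\<bar>I1\<bar> + 1)" by (intro mult_right_mono) auto
      also have "\<dots> = e / 2" by (simp add: field_simps)
      finally show "t * (\<bar>I1\<bar> + 1) \<le> e / 2" .
    qed
    have tp: "t ^ ?m > 0" using t by simp
    have "\<bar>F t - g x * I0\<bar> \<le> e / 2"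
    proof -
      have "F t * t ^ ?m = (\<integral>z. indicator S z * g z * \<eta> (w t z) \<partial>lebesgue)"
      proof -
        have "F t = (\<integral>z. indicator S z * g z * \<eta> (w t z) / t ^ ?m \<partial>lebesgue)"
          unfolding F_def by (rule Bochner_Integration.integral_cong) auto
        then show ?thesis using t(1) by simp
      qed
      moreover have "g x * I0 * t ^ ?m = (\<integral>z. g x * \<eta> (w t z) \<partial>lebesgue)"
        using I0[OF t(1)] by simp
      ultimately have "(F t - g x * I0) * t ^ ?m =
          (\<integral>z. indicator S z * g z * \<eta> (w t z) - g x * \<eta> (w t z) \<partial>lebesgue)"
        using ig\<eta>[of t] i\<eta>[OF t(1)] by (simp add: left_diff_distrib)
      moreover have "\<bar>F t - g x * I0\<bar> * t ^ ?m = \<bar>(F t - g x * I0) * t ^ ?m\<bar>"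
        using t(1) by (simp add: abs_mult)
      ultimately have "\<bar>F t - g x * I0\<bar> * t ^ ?m =
          \<bar>\<integral>z. indicator S z * g z * \<eta> (w t z) - g x * \<eta> (w t z) \<partial>lebesgue\<bar>"
        by (simp only:)
      also have "\<dots> \<le> (\<integral>z. K * (indicator (cball x t) z * \<bar>g z - g x\<bar>) \<partial>lebesgue)"
      proof (rule order_trans[OF integral_abs_bound integral_mono])
        show "integrable lebesgue (\<lambda>z. \<bar>indicator S z * g z * \<eta> (w t z) - g x * \<eta> (w t z)\<bar>)"
          by (intro integrable_abs Bochner_Integration.integrable_diff ig\<eta> integrable_mult_right i\<eta> t)
        have "integrable lebesgue (\<lambda>z. indicator (cball x t) z *\<^sub>R \<bar>indicator S z * g z - indicator S z * g x\<bar>)"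
          using iS gi by (intro integrable_mult_indicator integrable_abs Bochner_Integration.integrable_diff integrable_mult_left) auto
        moreover have "indicator (cball x t) z *\<^sub>R \<bar>indicator S z * g z - indicator S z * g x\<bar> = indicator (cball x t) z * \<bar>g z - g x\<bar>" for z
          using S(3)[OF t(3)] by (cases "z \<in> cball x t") (auto simp: indicator_def)
        ultimately have "integrable lebesgue (\<lambda>z. indicator (cball x t) z * \<bar>g z - g x\<bar>)" by (simp only:)
        then show "integrable lebesgue (\<lambda>z. K * (indicator (cball x t) z * \<bar>g z - g x\<bar>))"
          by (rule integrable_mult_right)
        fix z
        show "\<bar>indicator S z * g z * \<eta> (w t z) - g x * \<eta> (w t z)\<bar> \<le> K * (indicator (cball x t) z * \<bar>g z - g x\<bar>)"
        proof (cases "z \<in> cball x t")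
          case False
          then show ?thesis using \<eta>w0[OF t(1) False] by simp
        next
          case True
          then have z: "z \<in> S" using S(3)[OF t(3)] by blast
          have "\<bar>g z - g x\<bar> * \<bar>\<eta> (w t z)\<bar> \<le> \<bar>g z - g x\<bar> * K"
            using K by (intro mult_left_mono) auto
          then show ?thesis using z True by (simp add: abs_mult[symmetric] algebra_simps)
        qed
      qed
      also have "\<dots> = K * (LINT z:cball x t|lebesgue. \<bar>g z - g x\<bar>)" by (simp add: set_lebesgue_integral_def)
      also have "\<dots> \<le> K * (e' * t ^ ?m)" using d(2)[of t] t K0 by (intro mult_left_mono) auto
      also have "\<dots> = (K * e') * t ^ ?m" by simp
      finally have "\<bar>F t - g x * I0\<bar> \<le> K * e'" using tp by (simp only: mult_le_cancel_right_pos)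
      then show ?thesis using e' by linarith
    qed
    moreover have "\<bar>t * I1\<bar> \<le> e / 2"
    proof -
      have "\<bar>t * I1\<bar> \<le> t * (\<bar>I1\<bar> + 1)" using t(1) by (simp add: abs_mult)
      then show ?thesis using t(4) by linarith
    qed
    ultimately have "D t \<le> e" unfolding D_def by linarith
    moreover have "norm (D r - D t) \<le> K * \<kappa> * norm (r - t)"
      by (rule field_differentiable_bound[where S = "{t..r}" and f' = A])
        (use DA Ab t in \<open>auto intro: has_field_derivative_at_within\<close>)
    moreover have "K * \<kappa> * norm (r - t) \<le> K * \<kappa> * r"
      using Kk t by (intro mult_left_mono) auto
    ultimately show ?thesis by (simp add: abs_le_iff)
  qed
  have "D r \<le> K * \<kappa> * r" by (rule field_le_epsilon) (rule Db)
  \<comment> \<open>Undoing the normalisation: \<open>r * G x (w r z)\<close> is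
    \<open>G x (z - x)\<close> by homogeneity, and the factor \<open>r ^ m\<close> turns the bound
    of order \<open>r\<close> into one of order \<open>r ^ (m + 1)\<close>.\<close>
  moreover have "D r * r ^ ?m = (\<integral>z. indicator S z * (g z - g x - G x (z - x)) * \<eta> (w r z) \<partial>lebesgue)"
  proof -
    have "F r = (\<integral>z. indicator S z * g z * \<eta> (w r z) / r ^ ?m \<partial>lebesgue)"
      unfolding F_def by (rule Bochner_Integration.integral_cong) auto
    then have "D r * r ^ ?m = (\<integral>z. indicator S z * g z * \<eta> (w r z) \<partial>lebesgue)
        - (g x * (\<integral>z. \<eta> (w r z) \<partial>lebesgue) + r * (\<integral>z. G x (w r z) * \<eta> (w r z) \<partial>lebesgue))"
      unfolding D_def I0[OF r(1)] I1[OF r(1)] using r by (simp add: algebra_simps)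
    also have "\<dots> = (\<integral>z. indicator S z * g z * \<eta> (w r z) - (g x * \<eta> (w r z) + r * (G x (w r z) * \<eta> (w r z))) \<partial>lebesgue)"
      using ig\<eta>[of r] i\<eta>[OF r(1)] iG\<eta>[OF r(1)] by simp
    also have "\<dots> = (\<integral>z. indicator S z * (g z - g x - G x (z - x)) * \<eta> (w r z) \<partial>lebesgue)"
    proof (rule Bochner_Integration.integral_cong[OF refl])
      fix z
      have "r * G x (w r z) = G x (r *\<^sub>R w r z)" using lin[OF x] by (simp add: linear_cmul)
      also have "r *\<^sub>R w r z = z - x" using r by (simp add: w_def)
      finally have rG: "r * (G x (w r z) * \<eta> (w r z)) = G x (z - x) * \<eta> (w r z)" by (simp only: mult.assoc[symmetric])
      show "indicator S z * g z * \<eta> (w r z) - (g x * \<eta> (w r z) + r * (G x (w r z) * \<eta> (w r z))) =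
          indicator S z * (g z - g x - G x (z - x)) * \<eta> (w r z)"
        unfolding rG cut[OF r(1) order_refl] by (simp add: left_diff_distrib)
    qed
    finally show ?thesis .
  qed
  moreover have "D r * r ^ ?m \<le> (K * \<kappa> * r) * r ^ ?m"
    using calculation(1) r by (intro mult_right_mono) auto
  ultimately show ?thesis by (simp add: S_def w_def mult_ac)
qed

section \<open>Differentiability in the mean\<close>

lemma set_integrable_continuous_compact:
  fixes f :: "'a::euclidean_space \<Rightarrow> real"
  assumes "compact S" "continuous_on S f"
  shows "set_integrable lebesgue S f"
  using borel_integrable_compact[OF assms]
  by (simp add: set_integrable_def integrable_completion borel_measurable_integrable)

text \<open>\<open>weak_derivative_test_bound\<close> sees a test function only through its
  supremum, so it applies with \<open>\<kappa> = e\<close> to every \<open>\<theta>\<close>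
  supported in the ball, and \<open>L1_bound_by_duality\<close> converts this into an estimate for
  the absolute value.\<close>

lemma weak_derivative_L1_bound:
  fixes g :: "real ^ 'm::finite \<Rightarrow> real"
  assumes gG: "has_weak_derivative_on g G \<Omega>" and \<Omega>: "open \<Omega>" "x \<in> \<Omega>"
    and LG: "\<And>i e. e > 0 \<Longrightarrow> \<exists>d>0. \<forall>h. 0 < h \<and> h < d \<longrightarrow>
        (LINT y:cball x h|lebesgue. \<bar>G y (axis i 1) - G x (axis i 1)\<bar>) \<le> e * h ^ CARD('m)"
    and Lg: "\<And>e. e > 0 \<Longrightarrow> \<exists>d>0. \<forall>h. 0 < h \<and> h < d \<longrightarrow>
        (LINT y:cball x h|lebesgue. \<bar>g y - g x\<bar>) \<le> e * h ^ CARD('m)"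
    and e: "e > 0"
  shows "\<exists>d>0. \<forall>r. 0 < r \<and> r < d \<longrightarrow> cball x r \<subseteq> \<Omega> \<and>
      set_integrable lebesgue (cball x r) (\<lambda>z. g z - g x - G x (z - x)) \<and>
      (LINT z:cball x r|lebesgue. \<bar>g z - g x - G x (z - x)\<bar>) \<le> e * r ^ (CARD('m) + 1)"
proof -
  let ?m = "CARD('m)"
  obtain R where R: "R > 0" "cball x R \<subseteq> \<Omega>"
    using open_contains_cball[THEN iffD1, OF \<Omega>(1), rule_format, OF \<Omega>(2)] by metis
  \<comment> \<open>One share for each of the \<open>m\<close> axes; together they make up the
    constant \<open>\<kappa> = e\<close>.\<close>
  have "e / ?m > 0" using e by simp
  then have "\<forall>i. \<exists>d>0. \<forall>h. 0 < h \<and> h < d \<longrightarrow>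
        (LINT y:cball x h|lebesgue. \<bar>G y (axis i 1) - G x (axis i 1)\<bar>) \<le> (e / ?m) * h ^ ?m"
    using LG by blast
  then obtain d where d: "\<And>i. d i > 0" "\<And>i h. 0 < h \<and> h < d i \<longrightarrow>
        (LINT y:cball x h|lebesgue. \<bar>G y (axis i 1) - G x (axis i 1)\<bar>) \<le> (e / ?m) * h ^ ?m"
    by metis
  define d0 where "d0 = min R (Min (range d))"
  have d0: "d0 > 0" "d0 \<le> R" "\<And>i. d0 \<le> d i"
    using R d(1) by (auto simp: d0_def min_le_iff_disj)
  have lx: "linear (G x)" using has_weak_derivative_onD(2)[OF gG \<Omega>(2)] .
  have Gc: "continuous_on UNIV (G x)"
    using lx by (simp add: linear_continuous_on linear_conv_bounded_linear)
  have sg: "set_integrable lebesgue (cball x s) g" "set_integrable lebesgue (cball x s) (\<lambda>z. G z v)" if "s \<le> R" for s v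
  proof -
    have "cball x s \<subseteq> \<Omega>" using R(2) that by (meson subset_cball subset_trans)
    then show "set_integrable lebesgue (cball x s) g" "set_integrable lebesgue (cball x s) (\<lambda>z. G z v)"
      using has_weak_derivative_onD(1,3)[OF gG] compact_cball[of x s] unfolding locally_integrable_on_def by simp_all
  qed
  have sc: "set_integrable lebesgue (cball x s) (\<lambda>_. c)" for s and c :: real
    by (rule set_integrable_const_lmeasurable) simp
  have W: "(LINT z:cball x s|lebesgue. (\<Sum>i\<in>UNIV. \<bar>G z (axis i 1) - G x (axis i 1)\<bar>)) \<le> e * s ^ ?m"
    if s: "0 < s" "s < d0" for s
  proof -
    have i: "integrable lebesgue (\<lambda>z. indicat_real (cball x s) z *\<^sub>R \<bar>G z (axis i 1) - G x (axis i 1)\<bar>)" for i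
      using set_integrable_abs[OF set_integral_diff(1)[OF sg(2)[of s "axis i 1"] sc]] s d0
      by (simp add: set_integrable_def)
    have "(LINT z:cball x s|lebesgue. (\<Sum>i\<in>UNIV. \<bar>G z (axis i 1) - G x (axis i 1)\<bar>)) =
      (\<Sum>i\<in>UNIV. (LINT z:cball x s|lebesgue. \<bar>G z (axis i 1) - G x (axis i 1)\<bar>))"
      unfolding set_lebesgue_integral_def scaleR_sum_right
      by (rule Bochner_Integration.integral_sum) (rule i)
    also have "\<dots> \<le> (\<Sum>i\<in>(UNIV :: 'm set). (e / ?m) * s ^ ?m)"
      using d(2) s d0(3) by (intro sum_mono) (meson less_le_trans)
    also have "\<dots> = e * s ^ ?m" by simp
    finally show ?thesis .
  qed
  have "cball x r \<subseteq> \<Omega> \<and>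
      set_integrable lebesgue (cball x r) (\<lambda>z. g z - g x - G x (z - x)) \<and>
      (LINT z:cball x r|lebesgue. \<bar>g z - g x - G x (z - x)\<bar>) \<le> e * r ^ (?m + 1)"
    if r: "0 < r" "r < d0" for r
  proof (intro conjI)
    show "cball x r \<subseteq> \<Omega>" using R(2) r d0(2) by (meson less_le_trans less_imp_le subset_cball subset_trans)
    have "continuous_on (cball x r) (\<lambda>z. G x (z - x))"
      by (rule continuous_on_compose2[OF Gc]) (auto intro: continuous_intros)
    then show int: "set_integrable lebesgue (cball x r) (\<lambda>z. g z - g x - G x (z - x))"
      using r d0(2) by (intro set_integral_diff(1) sg sc set_integrable_continuous_compact) auto
    show "(LINT z:cball x r|lebesgue. \<bar>g z - g x - G x (z - x)\<bar>) \<le> e * r ^ (?m + 1)"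
    proof (rule L1_bound_by_duality[OF int r(1)])
      fix \<theta> :: "real ^ 'm \<Rightarrow> real" and K
      assume \<theta>: "C1_on UNIV \<theta>" "\<And>z. z \<notin> cball x r \<Longrightarrow> \<theta> z = 0" "\<And>z. \<bar>\<theta> z\<bar> \<le> K"
      \<comment> \<open>\<open>\<theta>\<close> transported from the ball of radius \<open>r\<close>
        to the unit ball, with the same bound \<open>K\<close>.\<close>
      define \<eta> where "\<eta> = (\<lambda>w. \<theta> (r *\<^sub>R w + x))"
      have "C1_on UNIV \<eta>"
        unfolding \<eta>_def
        by (intro C1_on_compose[OF _ \<theta>(1)] C1_on_add C1_on_const C1_on_bounded_linear bounded_linear_scaleR_right) auto
      moreover have "\<eta> w = 0" if "w \<notin> cball 0 1" for w
        using that r(1) unfolding \<eta>_def by (intro \<theta>(2)) (simp add: dist_norm)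
      moreover have "\<bar>\<eta> w\<bar> \<le> K" for w unfolding \<eta>_def by (rule \<theta>(3))
      ultimately have A: "(\<integral>z. indicator (cball x R) z * (g z - g x - G x (z - x)) * \<eta> ((z - x) /\<^sub>R r) \<partial>lebesgue)
          \<le> K * e * r ^ (?m + 1)"
        using r d0(2) W by (intro weak_derivative_test_bound[OF gG R(2)] Lg) auto
      have B: "indicator (cball x R) z * (g z - g x - G x (z - x)) * \<eta> ((z - x) /\<^sub>R r) =
          indicator (cball x r) z *\<^sub>R ((g z - g x - G x (z - x)) * \<theta> z)" for z
      proof -
        have "\<eta> ((z - x) /\<^sub>R r) = \<theta> z" using r(1) by (simp add: \<eta>_def)
        moreover have "cball x r \<subseteq> cball x R" using r d0(2) by (intro subset_cball) simp
        ultimately show ?thesis using \<theta>(2)[of z] by (cases "z \<in> cball x r") (auto simp: indicator_def)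
      qed
      show "(LINT z:cball x r|lebesgue. (g z - g x - G x (z - x)) * \<theta> z) \<le> e * r ^ (?m + 1) * K"
        using A unfolding set_lebesgue_integral_def B by (simp only: mult_ac)
    qed
  qed
  with d0(1) show ?thesis by blast
qed

text \<open>A first order Taylor expansion in the mean, in the sense of Calderon and Zygmund:
  \<open>r ^ (m + 1)\<close> is \<open>r\<close> times the order of the volume of the ball.
  Integrability is demanded since the integral of a nonintegrable function is \<open>0\<close> by
  convention.\<close>

definition L1_differentiable_at ::
    "(real ^ 'm::finite \<Rightarrow> real) \<Rightarrow> (real ^ 'm \<Rightarrow> real) \<Rightarrow> real ^ 'm \<Rightarrow> bool" where
  "L1_differentiable_at g L x \<longleftrightarrow> (\<forall>e>0. \<exists>d>0. \<forall>r. 0 < r \<and> r < d \<longrightarrow>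
      set_integrable lebesgue (cball x r) (\<lambda>z. g z - g x - L (z - x)) \<and>
      (LINT z:cball x r|lebesgue. \<bar>g z - g x - L (z - x)\<bar>) \<le> e * r ^ (CARD('m) + 1))"

lemma weak_derivative_L1_differentiable:
  fixes g :: "real ^ 'm::finite \<Rightarrow> real"
  assumes gG: "has_weak_derivative_on g G \<Omega>" and \<Omega>: "open \<Omega>"
  shows "negligible {x \<in> \<Omega>. \<not> L1_differentiable_at g (G x) x}"
proof (rule negligible_subset)
  define P where "P = (\<lambda>(f :: real ^ 'm \<Rightarrow> real) x. \<forall>e>0. \<exists>d>0. \<forall>h. 0 < h \<and> h < d \<longrightarrow>
        (LINT y:cball x h|lebesgue. \<bar>f y - f x\<bar>) \<le> e * h ^ CARD('m))"
  \<comment> \<open>Linearity of \<open>G z\<close> reduces the Lebesgue points of the derivative to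
    those of its values on the \<open>m\<close> axes, so finitely many null sets are
    discarded.\<close>
  let ?N = "{x \<in> \<Omega>. \<not> P g x} \<union> (\<Union>i\<in>UNIV. {x \<in> \<Omega>. \<not> P (\<lambda>z. G z (axis i 1)) x})"
  have "negligible {x \<in> \<Omega>. \<not> P f x}" if "locally_integrable_on f \<Omega>" for f
    unfolding P_def using that \<Omega> by (rule Lebesgue_points_locally_integrable)
  note N = this[OF has_weak_derivative_onD(1)[OF gG]] this[OF has_weak_derivative_onD(3)[OF gG]]
  show "negligible ?N" by (intro negligible_Un negligible_Union) (auto simp: N)
  have "L1_differentiable_at g (G x) x" if x: "x \<in> \<Omega>" "P g x" "\<And>i. P (\<lambda>z. G z (axis i 1)) x" for x
    unfolding L1_differentiable_at_def
  proof (intro allI impI)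
    fix e :: real assume e: "e > 0"
    have "\<exists>d>0. \<forall>r. 0 < r \<and> r < d \<longrightarrow> cball x r \<subseteq> \<Omega> \<and>
      set_integrable lebesgue (cball x r) (\<lambda>z. g z - g x - G x (z - x)) \<and>
      (LINT z:cball x r|lebesgue. \<bar>g z - g x - G x (z - x)\<bar>) \<le> e * r ^ (CARD('m) + 1)"
      by (rule weak_derivative_L1_bound[OF gG \<Omega> x(1) _ _ e]) (use x(2,3) in \<open>simp_all add: P_def\<close>)
    then show "\<exists>d>0. \<forall>r. 0 < r \<and> r < d \<longrightarrow>
      set_integrable lebesgue (cball x r) (\<lambda>z. g z - g x - G x (z - x)) \<and>
      (LINT z:cball x r|lebesgue. \<bar>g z - g x - G x (z - x)\<bar>) \<le> e * r ^ (CARD('m) + 1)"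
      by (elim exE conjE) (intro exI conjI, assumption, simp)
  qed
  then show "{x \<in> \<Omega>. \<not> L1_differentiable_at g (G x) x} \<subseteq> ?N" by blast
qed

text \<open>Chebyshev's inequality needs a positive lower bound for \<open>Q\<close>, but
  \<open>\<epsilon> * dist y z\<close> degenerates at \<open>z\<close>. So a ball of radius
  \<open>\<delta> * \<rho>\<close> is set aside, whose volume is a small fraction of
  \<open>\<rho> ^ m\<close>; on the rest of \<open>E\<close> within radius \<open>\<rho>\<close>,
  \<open>Q\<close> is at least \<open>\<epsilon> * (\<delta> * \<rho>)\<close>.\<close>

lemma density_zero_of_L1_small:
  fixes Q :: "real ^ 'm::finite \<Rightarrow> real"
  assumes E: "E \<in> sets lebesgue" and Q0: "\<And>y. 0 \<le> Q y" and \<epsilon>: "\<epsilon> > 0" and R: "R > 0"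
    and EQ: "\<And>y. y \<in> E \<Longrightarrow> y \<in> ball z R \<Longrightarrow> \<epsilon> * dist y z \<le> Q y"
    and L1: "\<And>e. e > 0 \<Longrightarrow> \<exists>d>0. \<forall>r. 0 < r \<and> r < d \<longrightarrow> set_integrable lebesgue (cball z r) Q \<and>
      (LINT y:cball z r|lebesgue. Q y) \<le> e * r ^ (CARD('m) + 1)"
  shows "((\<lambda>\<rho>. measure lebesgue (E \<inter> ball z \<rho>) / \<rho> ^ CARD('m)) \<longlongrightarrow> 0) (at_right 0)"
proof (rule tendstoI)
  let ?m = "CARD('m)"
  fix \<tau> :: real assume \<tau>: "\<tau> > 0"
  define V where "V = unit_ball_vol (real ?m)"
  have V: "V \<ge> 0" by (simp add: V_def)
  \<comment> \<open>As \<open>\<delta> \<le> 1\<close> and \<open>m \<ge> 1\<close>,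
    \<open>\<delta> ^ m \<le> \<delta>\<close>, and the ball set aside has measure at most
    \<open>\<tau> / 4 * \<rho> ^ m\<close>.\<close>
  define \<delta> where "\<delta> = min 1 (\<tau> / (4 * (V + 1)))"
  have \<delta>: "0 < \<delta>" "\<delta> \<le> 1" using \<tau> V by (auto simp: \<delta>_def)
  have "V * \<delta> ^ ?m \<le> (V + 1) * \<delta>"
  proof (rule mult_mono)
    have "\<delta> ^ ?m \<le> \<delta> ^ 1" using \<delta> by (intro power_decreasing) (auto simp: Suc_leI)
    then show "\<delta> ^ ?m \<le> \<delta>" by simp
  qed (use \<delta> V in auto)
  also have "\<dots> \<le> (V + 1) * (\<tau> / (4 * (V + 1)))"
    using V by (intro mult_left_mono) (auto simp: \<delta>_def)
  also have "\<dots> = \<tau> / 4" using V by (simp add: field_simps)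
  finally have V\<delta>: "V * \<delta> ^ ?m \<le> \<tau> / 4" .
  \<comment> \<open>Chosen so that \<open>e * \<rho> ^ (m + 1)\<close> divided by the lower bound
    \<open>\<epsilon> * (\<delta> * \<rho>)\<close> is again \<open>\<tau> / 4 * \<rho> ^ m\<close>;
    the sum of the two quarters is strictly below \<open>\<tau> * \<rho> ^ m\<close>.\<close>
  define e where "e = \<tau> * \<epsilon> * \<delta> / 4"
  have e: "e > 0" using \<tau> \<epsilon> \<delta> by (simp add: e_def)
  obtain d where d: "d > 0" and dr: "\<And>r. 0 < r \<and> r < d \<longrightarrow> set_integrable lebesgue (cball z r) Q \<and>
      (LINT y:cball z r|lebesgue. Q y) \<le> e * r ^ (?m + 1)"
    using L1[OF e] by (elim exE conjE) (rule that, assumption, simp)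
  have main: "measure lebesgue (E \<inter> ball z \<rho>) \<le> (\<tau> / 2) * \<rho> ^ ?m" if \<rho>: "0 < \<rho>" "\<rho> < min d R" for \<rho>
  proof -
    have Qi: "integrable lebesgue (\<lambda>y. indicat_real (cball z \<rho>) y *\<^sub>R Q y)"
      and Qb: "(LINT y:cball z \<rho>|lebesgue. Q y) \<le> e * \<rho> ^ (?m + 1)"
      using dr[of \<rho>] \<rho> by (simp_all add: set_integrable_def)
    have bl: "ball z s \<in> lmeasurable" for s by simp
    define A where "A = (E \<inter> ball z \<rho>) - ball z (\<delta> * \<rho>)"
    have Al: "A \<in> lmeasurable"
      unfolding A_def using E by (intro fmeasurable_Diff fmeasurable_Int_fmeasurable[OF _ E, of "ball z \<rho>", unfolded Int_commute[of "ball z \<rho>"]] bl) auto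
    have c: "\<epsilon> * (\<delta> * \<rho>) > 0" using \<epsilon> \<delta> \<rho> by simp
    have "\<epsilon> * (\<delta> * \<rho>) * measure lebesgue A = (\<integral>y. \<epsilon> * (\<delta> * \<rho>) * indicat_real A y \<partial>lebesgue)"
      using Al by simp
    also have "\<dots> \<le> (\<integral>y. indicat_real (cball z \<rho>) y *\<^sub>R Q y \<partial>lebesgue)"
    proof (rule integral_mono[OF _ Qi])
      show "integrable lebesgue (\<lambda>y. \<epsilon> * (\<delta> * \<rho>) * indicat_real A y)"
        using Al by (intro integrable_mult_right integrable_real_indicator) (auto simp: fmeasurable_def)
      fix y
      show "\<epsilon> * (\<delta> * \<rho>) * indicat_real A y \<le> indicat_real (cball z \<rho>) y *\<^sub>R Q y"
      proof (cases "y \<in> A")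
        case True
        then have y: "y \<in> E" "dist z y < \<rho>" "\<delta> * \<rho> \<le> dist z y" by (auto simp: A_def)
        have "\<epsilon> * (\<delta> * \<rho>) \<le> \<epsilon> * dist y z" using y(3) \<epsilon> by (intro mult_left_mono) (auto simp: dist_commute)
        also have "\<dots> \<le> Q y" using y \<rho> by (intro EQ) auto
        finally show ?thesis using True y by simp
      qed (simp add: Q0)
    qed
    also have "\<dots> \<le> e * \<rho> ^ (?m + 1)" using Qb by (simp add: set_lebesgue_integral_def)
    also have "\<dots> = \<epsilon> * (\<delta> * \<rho>) * (\<tau> / 4 * \<rho> ^ ?m)" by (simp add: e_def)
    finally have mA: "measure lebesgue A \<le> \<tau> / 4 * \<rho> ^ ?m"
      by (rule mult_left_le_imp_le) (rule c)
    have "measure lebesgue (E \<inter> ball z \<rho>) \<le> measure lebesgue (A \<union> ball z (\<delta> * \<rho>))"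
    proof (rule measure_mono_fmeasurable)
      show "A \<union> ball z (\<delta> * \<rho>) \<in> lmeasurable" using Al bl by (rule fmeasurable.Un)
      show "E \<inter> ball z \<rho> \<in> sets lebesgue" using E by (intro sets.Int) auto
    qed (auto simp: A_def)
    also have "\<dots> \<le> measure lebesgue A + measure lebesgue (ball z (\<delta> * \<rho>))"
      by (rule measure_Un_le) (use Al bl in auto)
    also have "measure lebesgue (ball z (\<delta> * \<rho>)) = measure lborel (ball z (\<delta> * \<rho>))"
      by (rule measure_completion) simp
    also have "\<dots> = V * \<delta> ^ ?m * \<rho> ^ ?m"
      using \<delta> \<rho> by (simp add: content_ball V_def power_mult_distrib)
    also have "\<dots> \<le> \<tau> / 4 * \<rho> ^ ?m"
      using V\<delta> \<rho> by (intro mult_right_mono) auto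
    finally show ?thesis using mA by linarith
  qed
  show "\<forall>\<^sub>F \<rho> in at_right 0. dist (measure lebesgue (E \<inter> ball z \<rho>) / \<rho> ^ ?m) 0 < \<tau>"
    unfolding eventually_at_right_field
  proof (intro exI[of _ "min d R"] conjI allI impI)
    show "0 < min d R" using d R by simp
    fix \<rho> :: real assume \<rho>: "0 < \<rho>" "\<rho> < min d R"
    then have p: "\<rho> ^ ?m > 0" by simp
    have "measure lebesgue (E \<inter> ball z \<rho>) / \<rho> ^ ?m \<le> \<tau> / 2"
      using main[OF \<rho>] by (simp only: pos_divide_le_eq[OF p])
    moreover have "0 \<le> measure lebesgue (E \<inter> ball z \<rho>) / \<rho> ^ ?m" using \<rho> by simp
    ultimately show "dist (measure lebesgue (E \<inter> ball z \<rho>) / \<rho> ^ ?m) 0 < \<tau>"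
      unfolding dist_real_def using \<tau> by linarith
  qed
qed

section \<open>Charts\<close>

lemma is_chartD:
  assumes "is_chart c"
  shows "open (fst c)" "open (snd c ` fst c)" "continuous_on (fst c) (snd c)"
    "continuous_on (snd c ` fst c) (chart_inv c)"
    "y \<in> fst c \<Longrightarrow> chart_inv c (snd c y) = y"
    "z \<in> snd c ` fst c \<Longrightarrow> snd c (chart_inv c z) = z"
    "z \<in> snd c ` fst c \<Longrightarrow> chart_inv c z \<in> fst c"
  using assms unfolding is_chart_def homeomorphism_def by auto

lemma chart_image_open:
  assumes c: "is_chart c" and U: "open U"
  shows "open (snd c ` (fst c \<inter> U))"
proof -
  have "snd c ` (fst c \<inter> U) = snd c ` fst c \<inter> chart_inv c -` U"
    using is_chartD[OF c] by (auto simp: image_iff)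
  then show ?thesis
    using continuous_open_preimage[OF is_chartD(4,2)[OF c] U] by simp
qed

lemma local_chartsD:
  assumes "c \<in> local_charts A"
  shows "is_chart c" "d \<in> A \<Longrightarrow> C1_compatible c d"
  using assms by (auto simp: local_charts_def)

lemma atlas_chart_local: "C1_atlas A \<Longrightarrow> d \<in> A \<Longrightarrow> d \<in> local_charts A"
  by (auto simp: C1_atlas_def local_charts_def)

lemma atlas_covers:
  assumes "C1_atlas A"
  shows "\<exists>a\<in>A. x \<in> fst a"
proof -
  have "x \<in> (\<Union>c\<in>A. fst c)" using assms unfolding C1_atlas_def by simp
  then show ?thesis by blast
qed

lemma charts_atD:
  assumes "c \<in> charts_at A x"
  shows "c \<in> local_charts A" "x \<in> fst c"
  using assms by (auto simp: charts_at_def)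

lemma C1_compatible_differentiable:
  assumes "C1_compatible c d" "x \<in> fst c" "x \<in> fst d"
  shows "(snd d \<circ> chart_inv c) differentiable at (snd c x)"
    "(snd c \<circ> chart_inv d) differentiable at (snd d x)"
  using assms unfolding C1_compatible_def by (auto intro!: C1_on_differentiable)

lemma transition_has_derivative_compose:
  assumes c: "is_chart c" and d: "is_chart d" and x: "x \<in> fst c" "x \<in> fst d"
    and cd: "((snd d \<circ> chart_inv c) has_derivative L) (at (snd c x))"
    and de: "((h \<circ> chart_inv d) has_derivative M) (at (snd d x))"
  shows "((h \<circ> chart_inv c) has_derivative (M \<circ> L)) (at (snd c x))"
proof (rule has_derivative_transform_within_open)
  have "(snd d \<circ> chart_inv c) (snd c x) = snd d x" using is_chartD(5)[OF c x(1)] by simp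
  then show "(((h \<circ> chart_inv d) \<circ> (snd d \<circ> chart_inv c)) has_derivative (M \<circ> L)) (at (snd c x))"
    using diff_chain_at[OF cd] de by simp
  show "open (snd c ` (fst c \<inter> fst d))" by (rule chart_image_open[OF c is_chartD(1)[OF d]])
  show "snd c x \<in> snd c ` (fst c \<inter> fst d)" using x by blast
  fix z assume "z \<in> snd c ` (fst c \<inter> fst d)"
  then show "((h \<circ> chart_inv d) \<circ> (snd d \<circ> chart_inv c)) z = (h \<circ> chart_inv c) z"
    using is_chartD(5)[OF c] is_chartD(5)[OF d] by auto
qed

text \<open>Local charts are by definition compatible with the charts of the atlas only, so the
  transition between two of them is factored through an atlas chart around \<open>x\<close>.\<close>

lemma local_chart_transition_has_derivative:
  assumes A: "C1_atlas A" and c: "c \<in> charts_at A x" and d: "d \<in> charts_at A x"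
  shows "((snd d \<circ> chart_inv c) has_derivative frechet_derivative (snd d \<circ> chart_inv c) (at (snd c x))) (at (snd c x))"
proof -
  obtain a where a: "a \<in> A" "x \<in> fst a" using atlas_covers[OF A] by metis
  note cl = charts_atD[OF c] and dl = charts_atD[OF d]
  have "(snd a \<circ> chart_inv c) differentiable at (snd c x)"
    using C1_compatible_differentiable(1)[OF local_chartsD(2)[OF cl(1) a(1)] cl(2) a(2)] .
  moreover have "(snd d \<circ> chart_inv a) differentiable at (snd a x)"
    using C1_compatible_differentiable(2)[OF local_chartsD(2)[OF dl(1) a(1)] dl(2) a(2)] .
  ultimately obtain L M where "((snd a \<circ> chart_inv c) has_derivative L) (at (snd c x))"
      "((snd d \<circ> chart_inv a) has_derivative M) (at (snd a x))"
    unfolding differentiable_def by blast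
  then have "((snd d \<circ> chart_inv c) has_derivative (M \<circ> L)) (at (snd c x))"
    by (intro transition_has_derivative_compose[OF local_chartsD(1)[OF cl(1)]
        local_chartsD(1)[OF atlas_chart_local[OF A a(1)]] cl(2) a(2)])
  then show ?thesis by (meson differentiableI frechet_derivative_works)
qed

text \<open>\<open>chart_deriv_inv\<close> is an \<open>inv_into\<close>, so its values are tangent
  vectors once \<open>chart_deriv c\<close> is known to be onto.\<close>

lemma chart_deriv_inv_in_tangent_space:
  assumes A: "C1_atlas A" and c: "c \<in> charts_at A x"
  shows "chart_deriv_inv A c x w \<in> tangent_space A x"
proof -
  \<comment> \<open>The vector with component \<open>w\<close> in \<open>c\<close>, carried to the
    other charts by the transition derivatives; the chain rule makes its components
    consistent.\<close>
  define v where "v = (\<lambda>d. if d \<in> charts_at A x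
    then frechet_derivative (snd d \<circ> chart_inv c) (at (snd c x)) w else 0)"
  have "v \<in> tangent_space A x"
    unfolding tangent_space_def
  proof (intro CollectI conjI ballI allI impI)
    fix d e assume d: "d \<in> charts_at A x" and e: "e \<in> charts_at A x"
    have "((snd e \<circ> chart_inv c) has_derivative
        (frechet_derivative (snd e \<circ> chart_inv d) (at (snd d x)) \<circ>
         frechet_derivative (snd d \<circ> chart_inv c) (at (snd c x)))) (at (snd c x))"
      using transition_has_derivative_compose[OF local_chartsD(1)[OF charts_atD(1)[OF c]]
          local_chartsD(1)[OF charts_atD(1)[OF d]] charts_atD(2)[OF c] charts_atD(2)[OF d]
          local_chart_transition_has_derivative[OF A c d] local_chart_transition_has_derivative[OF A d e]] .
    from fun_cong[OF frechet_derivative_at[OF this], of w]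
    show "v e = frechet_derivative (snd e \<circ> chart_inv d) (at (snd d x)) (v d)"
      using d e by (simp add: v_def)
  qed (simp add: v_def)
  moreover have "chart_deriv c v = w"
  proof -
    note ch = local_chartsD(1)[OF charts_atD(1)[OF c]]
    have "((snd c \<circ> chart_inv c) has_derivative (\<lambda>h. h)) (at (snd c x))"
      by (rule has_derivative_transform_within_open[OF has_derivative_ident is_chartD(2)[OF ch]])
        (use charts_atD(2)[OF c] is_chartD(6)[OF ch] in auto)
    from fun_cong[OF frechet_derivative_at[OF this], of w]
    show ?thesis using c by (simp add: chart_deriv_def v_def)
  qed
  ultimately have "w \<in> chart_deriv c ` tangent_space A x" by blast
  then show ?thesis unfolding chart_deriv_inv_def by (rule inv_into_into)
qed

lemma tangent_spaceD:
  "v \<in> tangent_space A x \<Longrightarrow> c \<in> charts_at A x \<Longrightarrow> d \<in> charts_at A x \<Longrightarrow>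
    v d = frechet_derivative (snd d \<circ> chart_inv c) (at (snd c x)) (v c)"
  unfolding tangent_space_def by blast

text \<open>\<open>fun_deriv\<close> computes in a chart \<open>e\<close> picked by
  \<open>SOME\<close>, possibly different from \<open>d\<close>. Near \<open>y\<close> the function
  read in \<open>e\<close> is a component of the transition from \<open>e\<close> to
  \<open>d\<close>, and the consistency of the components of \<open>v\<close> converts
  \<open>v e\<close> into \<open>v d\<close>.\<close>

lemma fun_deriv_coordinate:
  assumes B: "C1_atlas B" and d: "d \<in> charts_at B y" and W: "open W" "y \<in> W" "W \<subseteq> fst d"
    and f: "\<And>y'. y' \<in> W \<Longrightarrow> f y' = snd d y' $ i" and v: "v \<in> tangent_space B y"
  shows "fun_deriv B f y v = v d $ i"
proof -
  define e where "e = (SOME e. e \<in> charts_at B y)"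
  have e: "e \<in> charts_at B y" unfolding e_def using d by (rule someI)
  note ech = local_chartsD(1)[OF charts_atD(1)[OF e]]
  have "((\<lambda>z. (snd d \<circ> chart_inv e) z $ i) has_derivative
      (\<lambda>h. frechet_derivative (snd d \<circ> chart_inv e) (at (snd e y)) h $ i)) (at (snd e y))"
    by (rule bounded_linear.has_derivative[OF bounded_linear_vec_nth local_chart_transition_has_derivative[OF B e d]])
  then have "((f \<circ> chart_inv e) has_derivative
      (\<lambda>h. frechet_derivative (snd d \<circ> chart_inv e) (at (snd e y)) h $ i)) (at (snd e y))"
    by (rule has_derivative_transform_within_open[OF _ chart_image_open[OF ech W(1)]])
      (use W charts_atD(2)[OF e] is_chartD(5)[OF ech] f in auto)
  from fun_cong[OF frechet_derivative_at[OF this], of "v e"]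
  have "fun_deriv B f y v = frechet_derivative (snd d \<circ> chart_inv e) (at (snd e y)) (v e) $ i"
    by (simp add: fun_deriv_def Let_def chart_deriv_def flip: e_def)
  also have "frechet_derivative (snd d \<circ> chart_inv e) (at (snd e y)) (v e) = v d"
    by (rule tangent_spaceD[OF v e d, symmetric])
  finally show ?thesis .
qed

text \<open>In a Hausdorff space the compact set \<open>KN\<close> is closed, so the chart domain
  and the complement of \<open>KN\<close> form an open cover. On the former the function comes from
  \<open>k\<close>, on the latter it is \<open>0\<close>, and \<open>C1_on_open_Un\<close> glues the
  two in every local chart.\<close>

lemma C1c_fun_from_chart:
  fixes B :: "('b::t2_space, 'n::finite) chart set"
  assumes B: "C1_atlas B" and d: "d \<in> B" and k: "C1_on UNIV k"
    and K: "compact K" "K \<subseteq> snd d ` fst d" "\<And>z. z \<notin> K \<Longrightarrow> k z = 0"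
  shows "C1c_fun B (\<lambda>y. if y \<in> fst d then k (snd d y) else 0)"
proof -
  define f where "f = (\<lambda>y. if y \<in> fst d then k (snd d y) else 0)"
  note dch = local_chartsD(1)[OF atlas_chart_local[OF B d]]
  define KN where "KN = chart_inv d ` K"
  have KN: "compact KN"
    unfolding KN_def by (intro compact_continuous_image continuous_on_subset[OF is_chartD(4)[OF dch]] K)
  have f0: "f y = 0" if "y \<notin> KN" for y
  proof (cases "y \<in> fst d")
    case True
    then have "snd d y \<notin> K" using that is_chartD(5)[OF dch True] unfolding KN_def by force
    then show ?thesis using K(3) by (simp add: f_def)
  qed (simp add: f_def)
  have KNd: "KN \<subseteq> fst d" unfolding KN_def using K(2) is_chartD(7)[OF dch] by blast
  have "C1_on (snd e ` fst e) (f \<circ> chart_inv e)" if e: "e \<in> local_charts B" for e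
  proof -
    note ech = local_chartsD(1)[OF e]
    have o1: "open (snd e ` (fst e \<inter> fst d))" by (rule chart_image_open[OF ech is_chartD(1)[OF dch]])
    have o2: "open (snd e ` (fst e \<inter> - KN))"
      by (rule chart_image_open[OF ech open_Compl[OF compact_imp_closed[OF KN]]])
    have "C1_on (snd e ` (fst e \<inter> fst d)) (snd d \<circ> chart_inv e)"
      using local_chartsD(2)[OF e d] unfolding C1_compatible_def by (rule conjunct1)
    from C1_on_compose[OF this k subset_UNIV]
    have 1: "C1_on (snd e ` (fst e \<inter> fst d)) (f \<circ> chart_inv e)"
      by (rule C1_on_cong_open[OF o1]) (use is_chartD(5)[OF ech] in \<open>auto simp: f_def\<close>)
    have 2: "C1_on (snd e ` (fst e \<inter> - KN)) (f \<circ> chart_inv e)"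
      by (rule C1_on_cong_open[OF o2 C1_on_const[where c = 0]]) (use is_chartD(5)[OF ech] f0 in auto)
    have "snd e ` (fst e \<inter> fst d) \<union> snd e ` (fst e \<inter> - KN) = snd e ` fst e"
      using KNd by blast
    then show ?thesis using C1_on_open_Un[OF o1 o2 1 2] by simp
  qed
  moreover have "compact (closure {y. f y \<noteq> 0})"
    by (rule compact_closure_support(1)[OF KN f0])
  ultimately show ?thesis unfolding C1c_fun_def f_def by blast
qed

text \<open>The component \<open>None\<close> is a cutoff: where it does not vanish, the others are the coordinates.\<close>

definition coordinate_functions ::
    "('b::topological_space, 'n::finite) chart set \<Rightarrow> ('b, 'n) chart \<Rightarrow> 'b set \<Rightarrow> ('n option \<Rightarrow> 'b \<Rightarrow> real) \<Rightarrow> bool"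
  where
  "coordinate_functions B d W k \<longleftrightarrow> d \<in> B \<and> open W \<and> W \<subseteq> fst d \<and> (\<forall>j. C1c_fun B (k j)) \<and>
     (\<forall>y\<in>W. k None y = 1) \<and> (\<forall>y. k None y \<noteq> 0 \<longrightarrow> y \<in> fst d \<and> (\<forall>i. k (Some i) y = snd d y $ i))"

lemma coordinate_functions_exist:
  fixes B :: "('b::t2_space, 'n::finite) chart set"
  assumes B: "C1_atlas B"
  obtains d W k where "coordinate_functions B d W k" "y \<in> W"
proof -
  obtain d where d: "d \<in> B" "y \<in> fst d" using atlas_covers[OF B] by metis
  note dch = local_chartsD(1)[OF atlas_chart_local[OF B d(1)]]
  define q where "q = snd d y"
  have "q \<in> snd d ` fst d" using d(2) by (simp add: q_def)
  then obtain R where R: "R > 0" "cball q R \<subseteq> snd d ` fst d"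
    using open_contains_cball[THEN iffD1, OF is_chartD(2)[OF dch], rule_format] by metis
  \<comment> \<open>Nested radii: \<open>W\<close> lies over the ball of radius
    \<open>\<rho>\<close>, where the cutoff \<open>b0\<close> is \<open>1\<close>. Wherever
    \<open>b0\<close> is nonzero the distance is below \<open>2 * \<rho>\<close>, where
    \<open>b1\<close> is \<open>1\<close> and \<open>b1 z * z $ i\<close> is the true coordinate.
    From \<open>3 * \<rho>\<close> on everything vanishes, still inside the chart.\<close>
  define \<rho> where "\<rho> = R / 3"
  have \<rho>: "0 < \<rho>" "cball q (3 * \<rho>) \<subseteq> snd d ` fst d" using R by (auto simp: \<rho>_def)
  have bump: "\<exists>f. C1_on UNIV f \<and> (\<forall>z. dist q z \<le> a \<longrightarrow> f z = 1) \<and> (\<forall>z. b \<le> dist q z \<longrightarrow> f z = (0::real))"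
    if "0 \<le> a" "a < b" for a b
    using that by (rule C1_bump) blast
  obtain b1 where b1: "C1_on UNIV b1" "\<And>z. dist q z \<le> 2 * \<rho> \<Longrightarrow> b1 z = 1" "\<And>z. 3 * \<rho> \<le> dist q z \<Longrightarrow> b1 z = (0::real)"
    using bump[of "2 * \<rho>" "3 * \<rho>"] \<rho>(1) by auto
  obtain b0 where b0: "C1_on UNIV b0" "\<And>z. dist q z \<le> \<rho> \<Longrightarrow> b0 z = 1" "\<And>z. 2 * \<rho> \<le> dist q z \<Longrightarrow> b0 z = (0::real)"
    using bump[of \<rho> "2 * \<rho>"] \<rho>(1) by auto
  define l where "l = (\<lambda>j z. case j of None \<Rightarrow> b0 z | Some i \<Rightarrow> b1 z * z $ i)"
  define k where "k = (\<lambda>j y. if y \<in> fst d then l j (snd d y) else 0)"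
  define W where "W = fst d \<inter> snd d -` ball q \<rho>"
  have l: "C1_on UNIV (l j)" for j
  proof (cases j)
    case None
    then show ?thesis using b0(1) by (simp add: l_def)
  next
    case (Some i)
    have "C1_on UNIV (\<lambda>z. b1 z * z $ i)"
      by (intro C1_on_mult b1(1) C1_on_bounded_linear bounded_linear_vec_nth)
    then show ?thesis using Some by (simp add: l_def)
  qed
  have l0: "l j z = 0" if "z \<notin> cball q (3 * \<rho>)" for j z
    using that b0(3)[of z] b1(3)[of z] \<rho>(1) by (cases j) (auto simp: l_def)
  have kC: "C1c_fun B (k j)" for j
    unfolding k_def by (rule C1c_fun_from_chart[OF B d(1) l compact_cball \<rho>(2) l0])
  have "coordinate_functions B d W k"
    unfolding coordinate_functions_def
  proof (intro conjI allI ballI impI)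
    show "open W" unfolding W_def
      by (rule continuous_open_preimage[OF is_chartD(3,1)[OF dch] open_ball])
    fix y' i assume nz: "k None y' \<noteq> 0"
    show y': "y' \<in> fst d" using nz by (auto simp: k_def split: if_splits)
    have "b0 (snd d y') \<noteq> 0" using nz y' by (simp add: k_def l_def)
    then have "dist q (snd d y') \<le> 2 * \<rho>" using b0(3)[of "snd d y'"] by linarith
    then show "k (Some i) y' = snd d y' $ i" using b1(2) y' by (simp add: k_def l_def)
  qed (use d kC b0(2) in \<open>auto simp: W_def k_def l_def\<close>)
  moreover have "y \<in> W" using d(2) \<rho>(1) by (simp add: W_def q_def)
  ultimately show thesis by (rule that)
qed


section \<open>The colocal weak derivative\<close>

lemma L1_differentiable_at_sum:
  fixes F :: "'j::finite \<Rightarrow> real ^ 'm::finite \<Rightarrow> real"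
  assumes "\<And>j. L1_differentiable_at (F j) (L j) z" and e: "e > 0"
  shows "\<exists>d>0. \<forall>r. 0 < r \<and> r < d \<longrightarrow>
      set_integrable lebesgue (cball z r) (\<lambda>y. \<Sum>j\<in>UNIV. \<bar>F j y - F j z - L j (y - z)\<bar>) \<and>
      (LINT y:cball z r|lebesgue. \<Sum>j\<in>UNIV. \<bar>F j y - F j z - L j (y - z)\<bar>) \<le> e * r ^ (CARD('m) + 1)"
proof -
  define h where "h = (\<lambda>j y. F j y - F j z - L j (y - z))"
  define n where "n = real CARD('j)"
  have n: "n > 0" by (simp add: n_def)
  have en: "e / n > 0" using e n by simp
  have "\<forall>j. \<exists>d>0. \<forall>r. 0 < r \<and> r < d \<longrightarrow> set_integrable lebesgue (cball z r) (h j) \<and>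
      (LINT y:cball z r|lebesgue. \<bar>h j y\<bar>) \<le> (e / n) * r ^ (CARD('m) + 1)"
    unfolding h_def
    using assms(1)[unfolded L1_differentiable_at_def, THEN spec, THEN mp, OF en] by (rule allI)
  then obtain d where d: "\<And>j. d j > 0" "\<And>j r. 0 < r \<and> r < d j \<longrightarrow> set_integrable lebesgue (cball z r) (h j) \<and>
      (LINT y:cball z r|lebesgue. \<bar>h j y\<bar>) \<le> (e / n) * r ^ (CARD('m) + 1)"
    by metis
  define d0 where "d0 = Min (range d)"
  have d0: "d0 > 0" "\<And>j. d0 \<le> d j" using d(1) by (auto simp: d0_def)
  have "set_integrable lebesgue (cball z r) (\<lambda>y. \<Sum>j\<in>UNIV. \<bar>h j y\<bar>) \<and>
      (LINT y:cball z r|lebesgue. \<Sum>j\<in>UNIV. \<bar>h j y\<bar>) \<le> e * r ^ (CARD('m) + 1)"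
    if r: "0 < r" "r < d0" for r
  proof
    have dr: "set_integrable lebesgue (cball z r) (h j)"
        "(LINT y:cball z r|lebesgue. \<bar>h j y\<bar>) \<le> (e / n) * r ^ (CARD('m) + 1)" for j
      using d(2)[of r j] r d0(2)[of j] by simp_all
    have i: "integrable lebesgue (\<lambda>y. indicat_real (cball z r) y *\<^sub>R \<bar>h j y\<bar>)" for j
      using set_integrable_abs[OF dr(1)[of j]] by (simp add: set_integrable_def)
    show "set_integrable lebesgue (cball z r) (\<lambda>y. \<Sum>j\<in>UNIV. \<bar>h j y\<bar>)"
      unfolding set_integrable_def scaleR_sum_right by (rule Bochner_Integration.integrable_sum) (rule i)
    have "(LINT y:cball z r|lebesgue. \<Sum>j\<in>UNIV. \<bar>h j y\<bar>) = (\<Sum>j\<in>UNIV. (LINT y:cball z r|lebesgue. \<bar>h j y\<bar>))"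
      unfolding set_lebesgue_integral_def scaleR_sum_right
      by (rule Bochner_Integration.integral_sum) (rule i)
    also have "\<dots> \<le> (\<Sum>j\<in>(UNIV :: 'j set). (e / n) * r ^ (CARD('m) + 1))"
      by (intro sum_mono dr(2))
    also have "\<dots> = e * r ^ (CARD('m) + 1)" using n by (simp add: n_def)
    finally show "(LINT y:cball z r|lebesgue. \<Sum>j\<in>UNIV. \<bar>h j y\<bar>) \<le> e * r ^ (CARD('m) + 1)" .
  qed
  with d0(1) show ?thesis unfolding h_def by blast
qed

text \<open>The composite of \<open>Df\<close>, \<open>Du\<close> and the inverse of the chart
  derivative. It is built from the given \<open>Du\<close>, whereas
  \<open>colocal_weak_derivative\<close> supplies for each \<open>f\<close> some \<open>G\<close>
  that agrees with it only almost everywhere.\<close>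

definition coordinate_derivative ::
    "('a::topological_space, 'm::finite) chart set \<Rightarrow> ('b::topological_space, 'n::finite) chart set
      \<Rightarrow> ('a \<Rightarrow> 'b) \<Rightarrow> ('a \<Rightarrow> ('a, 'm) tangent \<Rightarrow> ('b, 'n) tangent)
      \<Rightarrow> ('a, 'm) chart \<Rightarrow> ('b \<Rightarrow> real) \<Rightarrow> real ^ 'm \<Rightarrow> real ^ 'm \<Rightarrow> real" where
  "coordinate_derivative A B u Du c f z w =
     (let x = chart_inv c z in fun_deriv B f (u x) (Du x (chart_deriv_inv A c x w)))"

text \<open>Both properties are inherited from the weak derivative \<open>G\<close> wherever it
  agrees with \<open>Df\<close> after \<open>Du\<close> on the tangent space. The agreement is
  applied to the vectors \<open>chart_deriv_inv A c x w\<close>, which therefore have to be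
  tangent.\<close>

lemma colocal_weak_derivative_L1_differentiable:
  fixes A :: "('a::topological_space, 'm::finite) chart set" and B :: "('b::topological_space, 'n::finite) chart set"
  assumes A: "C1_atlas A" and Du: "colocal_weak_derivative A B u Du" and f: "C1c_fun B f"
    and c: "c \<in> local_charts A"
  shows "negligible {z \<in> snd c ` fst c. \<not> (linear (coordinate_derivative A B u Du c f z) \<and>
    L1_differentiable_at ((f \<circ> u) \<circ> chart_inv c) (coordinate_derivative A B u Du c f z) z)}"
    (is "negligible ?X")
proof -
  note ch = local_chartsD(1)[OF c]
  obtain G where G: "weak_derivative A (f \<circ> u) G"
    and ae: "almost_everywhere_in A (\<lambda>x. \<forall>v\<in>tangent_space A x. G x v = fun_deriv B f (u x) (Du x v))"
    using Du f unfolding colocal_weak_derivative_def by blast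
  define H where "H = (\<lambda>z w. G (chart_inv c z) (chart_deriv_inv A c (chart_inv c z) w))"
  have H: "has_weak_derivative_on ((f \<circ> u) \<circ> chart_inv c) H (snd c ` fst c)"
    using G c unfolding weak_derivative_def H_def by blast
  let ?E = "snd c ` ({x. \<not> (\<forall>v\<in>tangent_space A x. G x v = fun_deriv B f (u x) (Du x v))} \<inter> fst c)"
  let ?N = "{z \<in> snd c ` fst c. \<not> L1_differentiable_at ((f \<circ> u) \<circ> chart_inv c) (H z) z}"
  have "negligible ?E" using ae c unfolding almost_everywhere_in_def negligible_in_def by blast
  moreover have "negligible ?N" by (rule weak_derivative_L1_differentiable[OF H is_chartD(2)[OF ch]])
  ultimately have "negligible (?E \<union> ?N)" by (rule negligible_Un)
  moreover have "?X \<subseteq> ?E \<union> ?N"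
  proof
    fix z assume z: "z \<in> ?X"
    show "z \<in> ?E \<union> ?N"
    proof (rule ccontr)
      assume n: "z \<notin> ?E \<union> ?N"
      have zc: "z \<in> snd c ` fst c" using z by blast
      define x where "x = chart_inv c z"
      have x: "x \<in> fst c" "snd c x = z" using is_chartD(6,7)[OF ch zc] by (simp_all add: x_def)
      have "x \<notin> {x. \<not> (\<forall>v\<in>tangent_space A x. G x v = fun_deriv B f (u x) (Du x v))}"
        using n x by blast
      then have Gx: "G x v = fun_deriv B f (u x) (Du x v)" if "v \<in> tangent_space A x" for v
        using that by blast
      have "H z w = coordinate_derivative A B u Du c f z w" for w
        using Gx[OF chart_deriv_inv_in_tangent_space[OF A, of c x w]] c x(1)
        unfolding H_def coordinate_derivative_def Let_def x_def[symmetric] by (simp add: charts_at_def)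
      then have "H z = coordinate_derivative A B u Du c f z" by (rule ext)
      moreover have "linear (H z)" using has_weak_derivative_onD(2)[OF H zc] .
      ultimately show False using n z zc by auto
    qed
  qed
  ultimately show ?thesis by (rule negligible_subset)
qed

text \<open>Extended by \<open>0\<close>, the coordinates form a Borel map on the whole target,
  which can be composed with \<open>u\<close> without restricting to the preimage of the
  chart.\<close>

lemma chart_map_measurable:
  fixes u :: "'a::topological_space \<Rightarrow> 'b::topological_space"
  assumes u: "measurable_map A u" and c: "c \<in> local_charts A" and d: "is_chart d"
  shows "{z \<in> snd c ` fst c. u (chart_inv c z) \<in> fst d} \<in> sets (lebesgue_on (snd c ` fst c))"
    and "(\<lambda>z. if u (chart_inv c z) \<in> fst d then snd d (u (chart_inv c z)) else 0)
      \<in> borel_measurable (lebesgue_on (snd c ` fst c))"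
proof -
  have m: "(\<lambda>z. u (chart_inv c z)) \<in> borel_measurable (lebesgue_on (snd c ` fst c))"
    using u c unfolding measurable_map_def o_def by blast
  have "(\<lambda>z. u (chart_inv c z)) -` fst d \<inter> space (lebesgue_on (snd c ` fst c)) \<in> sets (lebesgue_on (snd c ` fst c))"
    by (rule measurable_sets[OF m]) (use is_chartD(1)[OF d] in simp)
  moreover have "(\<lambda>z. u (chart_inv c z)) -` fst d \<inter> space (lebesgue_on (snd c ` fst c)) =
      {z \<in> snd c ` fst c. u (chart_inv c z) \<in> fst d}" by auto
  ultimately show "{z \<in> snd c ` fst c. u (chart_inv c z) \<in> fst d} \<in> sets (lebesgue_on (snd c ` fst c))" by (simp only:)
  have "(\<lambda>y. if y \<in> fst d then snd d y else 0) \<in> borel_measurable borel"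
    using borel_measurable_continuous_on_restrict[OF is_chartD(3)[OF d]] is_chartD(1)[OF d]
    by (subst measurable_restrict_space_iff[symmetric]) auto
  from measurable_compose[OF m this]
  show "(\<lambda>z. if u (chart_inv c z) \<in> fst d then snd d (u (chart_inv c z)) else 0)
      \<in> borel_measurable (lebesgue_on (snd c ` fst c))" .
qed

lemma exceptional_set_image_measurable:
  fixes u :: "'a::topological_space \<Rightarrow> 'b::topological_space"
    and c :: "('a, 'm::finite) chart" and d :: "('b, 'n::finite) chart"
  assumes u: "measurable_map A u" and c: "c \<in> local_charts A" and d: "is_chart d"
    and lin: "linear (\<lambda>w. chart_deriv d (\<xi> (chart_deriv_inv A c x w)))"
  shows "snd c ` exceptional_set A u x \<xi> c d \<epsilon> \<in> sets lebesgue"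
proof -
  note ch = local_chartsD(1)[OF c]
  define \<Omega> where "\<Omega> = snd c ` fst c"
  have \<Omega>: "\<Omega> \<in> sets lebesgue" using is_chartD(2)[OF ch] by (simp add: \<Omega>_def lebesgue_openin)
  define U where "U = (\<lambda>z. u (chart_inv c z))"
  \<comment> \<open>The value \<open>0\<close> outside the chart is arbitrary: \<open>J\<close>
    enters the exceptional set only through \<open>I \<inter> J\<close>, and on \<open>I\<close> the
    default does not occur.\<close>
  define v where "v = (\<lambda>z. if U z \<in> fst d then snd d (U z) else 0)"
  define \<Lambda> where "\<Lambda> = (\<lambda>w. chart_deriv d (\<xi> (chart_deriv_inv A c x w)))"
  define I where "I = {z \<in> \<Omega>. U z \<in> fst d}"
  define J where "J = {z \<in> \<Omega>. \<epsilon> * norm (z - snd c x) < norm (v z - snd d (u x) - \<Lambda> (z - snd c x))}"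
  have I: "I \<in> sets (lebesgue_on \<Omega>)" and v: "v \<in> borel_measurable (lebesgue_on \<Omega>)"
    using chart_map_measurable[OF u c d] unfolding I_def v_def U_def \<Omega>_def by simp_all
  have \<Lambda>c: "continuous_on UNIV \<Lambda>"
    using lin by (simp add: \<Lambda>_def linear_continuous_on linear_conv_bounded_linear)
  have cm: "f \<in> borel_measurable (lebesgue_on \<Omega>)" if "continuous_on UNIV f" for f :: "real ^ 'm \<Rightarrow> 'c::topological_space"
    by (intro measurable_restrict_space1 measurable_completion) (simp add: that borel_measurable_continuous_onI)
  have [measurable]: "(\<lambda>z. \<Lambda> (z - snd c x)) \<in> borel_measurable (lebesgue_on \<Omega>)"
    by (intro cm continuous_on_compose2[OF \<Lambda>c] continuous_intros) auto
  note [measurable] = v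
  have "(\<lambda>z. norm (v z - snd d (u x) - \<Lambda> (z - snd c x))) \<in> borel_measurable (lebesgue_on \<Omega>)"
    by measurable
  moreover have "(\<lambda>z. \<epsilon> * norm (z - snd c x)) \<in> borel_measurable (lebesgue_on \<Omega>)"
    by (intro cm continuous_intros)
  ultimately have "{z \<in> space (lebesgue_on \<Omega>). \<epsilon> * norm (z - snd c x) < norm (v z - snd d (u x) - \<Lambda> (z - snd c x))}
      \<in> sets (lebesgue_on \<Omega>)"
    by (intro borel_measurable_less)
  then have J: "J \<in> sets (lebesgue_on \<Omega>)" by (simp add: J_def)
  have "(\<Omega> - I) \<union> (I \<inter> J) \<in> sets (lebesgue_on \<Omega>)"
    using I J sets.top[of "lebesgue_on \<Omega>"] by (intro sets.Un sets.Diff sets.Int) simp_all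
  then have "(\<Omega> - I) \<union> (I \<inter> J) \<in> sets lebesgue"
    using \<Omega> by (simp add: sets_restrict_space_iff)
  moreover have "snd c ` exceptional_set A u x \<xi> c d \<epsilon> = (\<Omega> - I) \<union> (I \<inter> J)"
  proof -
    have "y \<in> exceptional_set A u x \<xi> c d \<epsilon> \<longleftrightarrow> snd c y \<in> (\<Omega> - I) \<union> (I \<inter> J)" if "y \<in> fst c" for y
    proof -
      have "U (snd c y) = u y" "snd c y \<in> \<Omega>"
        using is_chartD(5)[OF ch that] that by (simp_all add: U_def \<Omega>_def)
      then show ?thesis
        unfolding exceptional_set_def I_def J_def v_def \<Lambda>_def using that by auto
    qed
    moreover have "exceptional_set A u x \<xi> c d \<epsilon> \<subseteq> fst c" unfolding exceptional_set_def by blast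
    moreover have "(\<Omega> - I) \<union> (I \<inter> J) \<subseteq> snd c ` fst c" unfolding I_def \<Omega>_def by blast
    ultimately show ?thesis by blast
  qed
  ultimately show ?thesis by (simp only:)
qed

text \<open>The remainders of all \<open>n + 1\<close> functions are added up in \<open>Q\<close>.
  On the exceptional set, near \<open>z\<close>, this sum dominates
  \<open>\<epsilon> * dist y z\<close> for one of two reasons: the coordinate values at
  \<open>u y\<close> are genuine and their remainders are large, or the cutoff has dropped from
  \<open>1\<close> to \<open>0\<close>.\<close>

lemma approximate_derivative_at:
  fixes A :: "('a::t2_space, 'm::finite) chart set" and B :: "('b::t2_space, 'n::finite) chart set"
  assumes A: "C1_atlas A" and B: "C1_atlas B" and u: "measurable_map A u"
    and T: "tangent_linear A B x (u x) (Du x)"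
    and k: "coordinate_functions B d W k" and ux: "u x \<in> W" and c: "c \<in> charts_at A x"
    and L1: "\<And>j. linear (coordinate_derivative A B u Du c (k j) (snd c x)) \<and>
      L1_differentiable_at ((k j \<circ> u) \<circ> chart_inv c) (coordinate_derivative A B u Du c (k j) (snd c x)) (snd c x)"
  shows "approximate_derivative A B u x (Du x)"
proof -
  let ?m = "CARD('m)"
  note cl = charts_atD[OF c] and ch = local_chartsD(1)[OF charts_atD(1)[OF c]]
  define z where "z = snd c x"
  have x: "chart_inv c z = x" using is_chartD(5)[OF ch cl(2)] by (simp add: z_def)
  have kd: "d \<in> B" "open W" "W \<subseteq> fst d" and k1: "\<And>y. y \<in> W \<Longrightarrow> k None y = 1"
    and kn: "\<And>y. k None y \<noteq> 0 \<Longrightarrow> y \<in> fst d" "\<And>y i. k None y \<noteq> 0 \<Longrightarrow> k (Some i) y = snd d y $ i"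
    using k unfolding coordinate_functions_def by auto
  have dl: "d \<in> charts_at B (u x)"
    using atlas_chart_local[OF B kd(1)] kd(3) ux by (auto simp: charts_at_def)
  note dch = local_chartsD(1)[OF charts_atD(1)[OF dl]]
  define L where "L = (\<lambda>j. coordinate_derivative A B u Du c (k j) z)"
  define F where "F = (\<lambda>j. (k j \<circ> u) \<circ> chart_inv c)"
  have Llin: "linear (L j)" and LF: "L1_differentiable_at (F j) (L j) z" for j
    using L1[of j] by (simp_all add: L_def F_def z_def)
  define \<Lambda> where "\<Lambda> = (\<lambda>w. chart_deriv d (Du x (chart_deriv_inv A c x w)))"
  have \<Lambda>i: "\<Lambda> w $ i = L (Some i) w" for w i
  proof -
    have "Du x (chart_deriv_inv A c x w) \<in> tangent_space B (u x)"
      using T chart_deriv_inv_in_tangent_space[OF A c] unfolding tangent_linear_def by blast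
    moreover have "k (Some i) y' = snd d y' $ i" if "y' \<in> W" for y' using kn(2)[of y'] k1[OF that] by simp
    ultimately show ?thesis
      unfolding \<Lambda>_def L_def coordinate_derivative_def Let_def x chart_deriv_def
      by (intro fun_deriv_coordinate[OF B dl kd(2) ux kd(3), symmetric])
  qed
  have \<Lambda>lin: "linear \<Lambda>"
    by (rule linearI) (simp_all add: vec_eq_iff \<Lambda>i linear_add[OF Llin] linear_cmul[OF Llin])
  obtain b where b: "\<And>w. norm (L None w) \<le> b * norm w" "b > 0"
    using bounded_linear.pos_bounded[of "L None"] Llin[of None] by (metis linear_conv_bounded_linear mult.commute)
  define Q where "Q = (\<lambda>y. \<Sum>j\<in>UNIV. \<bar>F j y - F j z - L j (y - z)\<bar>)"
  have Qj: "\<bar>F j y - F j z - L j (y - z)\<bar> \<le> Q y" for j y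
    unfolding Q_def by (rule member_le_sum) auto
  have Qsome: "(\<Sum>i\<in>UNIV. \<bar>F (Some i) y - F (Some i) z - L (Some i) (y - z)\<bar>) \<le> Q y" for y
    unfolding Q_def UNIV_option_conv by (simp add: sum.reindex)
  have dens: "snd c ` exceptional_set A u x (Du x) c d \<epsilon> \<in> sets lebesgue \<and>
        ((\<lambda>\<rho>. measure lebesgue (snd c ` exceptional_set A u x (Du x) c d \<epsilon> \<inter> ball (snd c x) \<rho>)
               / \<rho> ^ ?m) \<longlongrightarrow> 0) (at_right 0)" if \<epsilon>: "\<epsilon> > 0" for \<epsilon>
  proof
    define E where "E = snd c ` exceptional_set A u x (Du x) c d \<epsilon>"
    show Em: "snd c ` exceptional_set A u x (Du x) c d \<epsilon> \<in> sets lebesgue"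
      using \<Lambda>lin unfolding \<Lambda>_def by (rule exceptional_set_image_measurable[OF u cl(1) dch])
    have "((\<lambda>\<rho>. measure lebesgue (E \<inter> ball z \<rho>) / \<rho> ^ ?m) \<longlongrightarrow> 0) (at_right 0)"
    \<comment> \<open>Within this radius
      \<open>b * norm (y - z) + \<epsilon> * norm (y - z) \<le> 1\<close>, so a drop of the cutoff
      by \<open>1\<close> outweighs the linear term \<open>L None\<close> and still leaves
      \<open>\<epsilon> * norm (y - z)\<close>.\<close>
    proof (rule density_zero_of_L1_small[where Q = Q and \<epsilon> = \<epsilon> and R = "1 / (b + \<epsilon>)"])
      show "E \<in> sets lebesgue" using Em by (simp add: E_def)
      show "0 \<le> Q y" for y unfolding Q_def by (intro sum_nonneg) simp
      show "1 / (b + \<epsilon>) > 0" using b(2) \<epsilon> by simp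
      show "\<exists>d>0. \<forall>r. 0 < r \<and> r < d \<longrightarrow> set_integrable lebesgue (cball z r) Q \<and>
          (LINT y:cball z r|lebesgue. Q y) \<le> e * r ^ (?m + 1)" if "e > 0" for e
        unfolding Q_def by (rule L1_differentiable_at_sum[OF LF that])
      fix y assume yE: "y \<in> E" and yb: "y \<in> ball z (1 / (b + \<epsilon>))"
      from yE obtain y' where y': "y = snd c y'" "y' \<in> fst c"
        and ex: "u y' \<notin> fst d \<or> norm (snd d (u y') - snd d (u x) - \<Lambda> (y - z)) > \<epsilon> * norm (y - z)"
        unfolding E_def exceptional_set_def \<Lambda>_def z_def by auto
      have Fy: "F j y = k j (u y')" "F j z = k j (u x)" for j
        using is_chartD(5)[OF ch y'(2)] x by (simp_all add: F_def y'(1))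
      show "\<epsilon> * dist y z \<le> Q y"
      \<comment> \<open>The first case contains all points with \<open>u y'\<close> outside the
        chart, since a nonzero cutoff forces \<open>u y' \<in> fst d\<close>.\<close>
      proof (cases "k None (u y') = 0")
        case True
        have "(b + \<epsilon>) * norm (y - z) \<le> 1"
          using yb b(2) \<epsilon> by (simp add: dist_norm norm_minus_commute field_simps)
        then have "b * norm (y - z) + \<epsilon> * norm (y - z) \<le> 1" by (simp only: distrib_right)
        moreover have "\<bar>L None (y - z)\<bar> \<le> b * norm (y - z)" using b(1) by (metis real_norm_def)
        ultimately have "\<epsilon> * norm (y - z) \<le> \<bar>F None y - F None z - L None (y - z)\<bar>"
          unfolding Fy True k1[OF ux] by linarith
        then show ?thesis using Qj[of None y] unfolding dist_norm by linarith
      next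
        case False
        with ex kn(1) have "\<epsilon> * norm (y - z) < norm (snd d (u y') - snd d (u x) - \<Lambda> (y - z))" by blast
        also have "\<dots> \<le> (\<Sum>i\<in>UNIV. \<bar>(snd d (u y') - snd d (u x) - \<Lambda> (y - z)) $ i\<bar>)"
          by (rule norm_le_l1_cart)
        also have "\<dots> = (\<Sum>i\<in>UNIV. \<bar>F (Some i) y - F (Some i) z - L (Some i) (y - z)\<bar>)"
          unfolding Fy kn(2)[OF False] using kn(2)[of "u x"] k1[OF ux] by (simp add: \<Lambda>i)
        also have "\<dots> \<le> Q y" by (rule Qsome)
        finally show ?thesis unfolding dist_norm by simp
      qed
    qed (rule \<epsilon>)
    then show "((\<lambda>\<rho>. measure lebesgue (snd c ` exceptional_set A u x (Du x) c d \<epsilon> \<inter> ball (snd c x) \<rho>)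
               / \<rho> ^ ?m) \<longlongrightarrow> 0) (at_right 0)"
      unfolding E_def z_def .
  qed
  show ?thesis
    unfolding approximate_derivative_def using T c dl dens by blast
qed

theorem proposition1p9:
  fixes A :: "('a::{t2_space, second_countable_topology}, 'm::finite) chart set"
    and B :: "('b::{t2_space, second_countable_topology}, 'n::finite) chart set"
    and u :: "'a \<Rightarrow> 'b"
    and Du :: "'a \<Rightarrow> ('a, 'm) tangent \<Rightarrow> ('b, 'n) tangent"
  assumes "C1_atlas A" and "C1_atlas B"
    and "colocally_weakly_differentiable A B u"
    and "colocal_weak_derivative A B u Du"
  shows "almost_everywhere_in A (\<lambda>x. approximate_derivative A B u x (Du x))"
  unfolding almost_everywhere_in_def negligible_in_def
proof
  fix c assume c: "c \<in> local_charts A"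
  note A = assms(1) and B = assms(2)
  note ch = local_chartsD(1)[OF c]
  have u: "measurable_map A u" and T: "\<And>x. tangent_linear A B x (u x) (Du x)"
    using assms(4) unfolding colocal_weak_derivative_def measurable_bundle_morphism_def by simp_all
  have "\<exists>d W k. coordinate_functions B d W k \<and> y \<in> W" for y
    using coordinate_functions_exist[OF B] by metis
  then obtain d W k where k: "\<And>y. coordinate_functions B (d y) (W y) (k y)" and W: "\<And>y. y \<in> W y"
    by metis
  have "open V" if "V \<in> range W" for V using k that unfolding coordinate_functions_def by blast
  \<comment> \<open>Each coordinate system costs null sets, so only countably many may be used. The
    subcover is taken in the target, so every \<open>x\<close> finds a system with
    \<open>u x \<in> W y\<close> without any continuity of \<open>u\<close>.\<close>
  from this obtain F where F: "F \<subseteq> range W" "countable F" "\<Union>F = \<Union>(range W)" by (rule Lindelof)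
  then obtain Y where Y: "countable Y" "F = W ` Y" by (metis countable_subset_image)
  define X where "X = (\<lambda>f. {z \<in> snd c ` fst c. \<not> (linear (coordinate_derivative A B u Du c f z) \<and>
    L1_differentiable_at ((f \<circ> u) \<circ> chart_inv c) (coordinate_derivative A B u Du c f z) z)})"
  have "negligible (X (k y j))" for y j
    unfolding X_def using k[of y] unfolding coordinate_functions_def
    by (intro colocal_weak_derivative_L1_differentiable[OF A assms(4) _ c]) blast
  then have N: "negligible (\<Union>((\<lambda>(y, j). X (k y j)) ` (Y \<times> UNIV)))"
    using Y(1) by (intro negligible_countable_Union) auto
  show "negligible (snd c ` ({x. \<not> approximate_derivative A B u x (Du x)} \<inter> fst c))"
  proof (rule negligible_subset[OF N], rule subsetI, rule ccontr)
    fix z assume "z \<in> snd c ` ({x. \<not> approximate_derivative A B u x (Du x)} \<inter> fst c)"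
    then obtain x where x: "z = snd c x" "x \<in> fst c" "\<not> approximate_derivative A B u x (Du x)" by blast
    assume zN: "z \<notin> \<Union>((\<lambda>(y, j). X (k y j)) ` (Y \<times> UNIV))"
    have "u x \<in> \<Union>(range W)" using W by blast
    then obtain y where y: "y \<in> Y" "u x \<in> W y" using F(3) Y(2) by blast
    have "z \<notin> X (k y j)" for j using zN y(1) by auto
    then have "linear (coordinate_derivative A B u Du c (k y j) (snd c x)) \<and>
      L1_differentiable_at ((k y j \<circ> u) \<circ> chart_inv c) (coordinate_derivative A B u Du c (k y j) (snd c x)) (snd c x)" for j
      using x(1,2) unfolding X_def by blast
    moreover have "c \<in> charts_at A x" using c x(2) by (simp add: charts_at_def)
    ultimately have "approximate_derivative A B u x (Du x)"
      by (intro approximate_derivative_at[where u = u and Du = Du and x = x, OF A B u T k y(2)])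
    with x(3) show False by simp
  qed
qed

end
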